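(* There exists a positive operator $T_0\in \mathcal M_{1,\infty}$ such that $$\sup_{{\rm Tr}_\omega \in \mathcal{D}} {\rm Tr}_\omega(T_0) > \sup_{{\rm Tr}_\omega \in \mathcal{C}} {\rm Tr}_\omega(T_0),$$ where $\mathcal D$ is the set of all Dixmier traces on $\mathcal M_{1,\infty}$ and $\mathcal C\subseteq\mathcal D$ is the set of all Connes-Dixmier traces on $\mathcal M_{1,\infty}$.
   Context: Notation: $\log$ is the natural logarithm. $H$ is an infinite-dimensional separable Hilbert space and $B(H)$ is the algebra of bounded linear operators on $H$. For a compact operator $T\in B(H)$, $\mu(k,T)$, $k=0,1,2,\ldots$, denotes the $k$-th singular value of $T$, i.e. the eigenvalues of $|T|$ arranged in decreasing order counted with multiplicity, starting with index $0$. Dixmier ideal: $\mathcal M_{1,\infty}$ is the set of all compact operators $T\in B(H)$ with $\sup_{n\ge 0} \frac{1}{\log(2+n)}\sum_{k=0}^n\mu(k,T)<\infty$. Generalized limits: $l_\infty$ is the space of bounded sequences $x=(x_0,x_1,\ldots)$ with the sup norm, and $L_\infty=L_\infty(0,\infty)$ is the space of real-valued bounded Lebesgue measurable functions on $(0,\infty)$ with the essential sup norm. A generalized limit on $l_\infty$ (respectively, on $L_\infty$) is a normalized positive linear functional on $l_\infty$ (respectively, $L_\infty$) which equals the ordinary limit on convergent sequences (respectively, on functions convergent at infinity). For $n\in\mathbb N$ (so $n\ge1$) the dilation operator $\sigma_n:l_\infty\to l_\infty$ is $$\sigma_n(x_0,x_1,\ldots)=(\underbrace{x_0,\ldots,x_0}_{n},\underbrace{x_1,\ldots,x_1}_{n},\ldots).$$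 A generalized limit $\omega$ on $l_\infty$ is dilation invariant if $\omega(\sigma_n x)=\omega(x)$ for all $x\in l_\infty$ and all $n\in\mathbb N$. Dixmier traces: for every dilation invariant generalized limit $\omega$ on $l_\infty$, the weight $${\rm Tr}_\omega(T):=\omega\left(\left\{\frac{1}{\log(2+n)}\sum_{k=0}^n\mu(k,T)\right\}_{n=0}^\infty\right),\quad 0\le T\in\mathcal M_{1,\infty},$$ extends by linearity to a trace on $\mathcal M_{1,\infty}$, called a Dixmier trace. $\mathcal D$ is the set of all Dixmier traces. Connes-Dixmier traces: let $\pi:l_\infty\to L_\infty$ be $\pi(\{x_n\}_{n\ge0})=\sum_{n=0}^\infty x_n\chi_{(n,n+1]}$ and let $M:L_\infty\to L_\infty$ be the bounded operator $$(Mx)(t):=\frac1{\log t}\int_1^t x(s)\,\frac{ds}{s}.$$ For every generalized limit $\gamma$ on $L_\infty$, the functional $\omega=\gamma\circ M\circ\pi$ is a dilation invariant generalized limit on $l_\infty$. $\mathcal C\subseteq\mathcal D$ is the set of all Dixmier traces ${\rm Tr}_\omega$ with $\omega=\gamma\circ M\circ\pi$ for some generalized limit $\gamma$ on $L_\infty$. *)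

theory Defs
  imports "HOL-Analysis.Analysis"
begin

section \<open>Complex Hilbert spaces\<close>

text \<open>
  The library has real inner product spaces only.  A complex Hilbert space is a real one
  (with the real part of the complex inner product as its inner product) that carries a compatible
  complex scalar multiplication and a complex inner product, linear in the first argument.
  Norm, topology and completeness are then those of the library.
\<close>

class complex_hilbert = real_inner + complete_space +
  fixes scaleC :: "complex \<Rightarrow> 'a \<Rightarrow> 'a" (infixr "*\<^sub>C" 75)
    and cinner :: "'a \<Rightarrow> 'a \<Rightarrow> complex"
  assumes scaleC_add_right: "c *\<^sub>C (x + y) = c *\<^sub>C x + c *\<^sub>C y"
    and scaleC_add_left: "(c + d) *\<^sub>C x = c *\<^sub>C x + d *\<^sub>C x"
    and scaleC_scaleC: "c *\<^sub>C (d *\<^sub>C x) = (c * d) *\<^sub>C x"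
    and scaleC_of_real: "complex_of_real r *\<^sub>C x = r *\<^sub>R x"
    and cinner_commute: "cinner x y = cnj (cinner y x)"
    and cinner_add_left: "cinner (x + y) z = cinner x z + cinner y z"
    and cinner_scaleC_left: "cinner (c *\<^sub>C x) y = c * cinner x y"
    and Re_cinner: "Re (cinner x y) = inner x y"

global_interpretation complex_vector: vector_space "scaleC :: complex \<Rightarrow> 'a::complex_hilbert \<Rightarrow> 'a"
proof
  show "1 *\<^sub>C x = x" for x :: 'a
    using scaleC_of_real[of 1 x] by simp
qed (simp_all add: scaleC_add_right scaleC_add_left scaleC_scaleC)

section \<open>Operators and singular values\<close>

text \<open>Operators are plain functions; \<open>bounded_op T\<close> says that \<open>T\<close> lies in \<open>B(H)\<close>.\<close>

definition bounded_op :: "('a::complex_hilbert \<Rightarrow> 'a) \<Rightarrow> bool" where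
  "bounded_op T \<longleftrightarrow> bounded_linear T \<and> (\<forall>c x. T (c *\<^sub>C x) = c *\<^sub>C T x)"

definition compact_op :: "('a::complex_hilbert \<Rightarrow> 'a) \<Rightarrow> bool" where
  "compact_op T \<longleftrightarrow> bounded_op T \<and> compact (closure (T ` cball 0 1))"

definition positive_op :: "('a::complex_hilbert \<Rightarrow> 'a) \<Rightarrow> bool" where
  "positive_op T \<longleftrightarrow> bounded_op T \<and> (\<forall>x. cinner (T x) x \<in> \<real>\<^sub>\<ge>\<^sub>0)"

definition adjoint_op :: "('a::complex_hilbert \<Rightarrow> 'a) \<Rightarrow> 'a \<Rightarrow> 'a" where
  "adjoint_op T = (THE S. bounded_op S \<and> (\<forall>x y. cinner (T x) y = cinner x (S y)))"

definition abs_op :: "('a::complex_hilbert \<Rightarrow> 'a) \<Rightarrow> 'a \<Rightarrow> 'a" where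
  "abs_op T = (THE S. positive_op S \<and> S \<circ> S = adjoint_op T \<circ> T)"

definition eigenspace :: "('a::complex_hilbert \<Rightarrow> 'a) \<Rightarrow> complex \<Rightarrow> 'a set" where
  "eigenspace T c = {x. T x = c *\<^sub>C x}"

text \<open>
  The decreasing enumeration of the eigenvalues of \<open>|T|\<close>, for compact \<open>T\<close>: each \<open>r > 0\<close>
  occurs as often as its multiplicity as an eigenvalue (not at all if it is not an eigenvalue).
  If there are only finitely many positive eigenvalues, the sequence continues with zeros;
  otherwise zero does not occur, as it could not be reached in decreasing order.
\<close>

definition singular_value :: "nat \<Rightarrow> ('a::complex_hilbert \<Rightarrow> 'a) \<Rightarrow> real" where
  "singular_value k T =
    (THE s :: nat \<Rightarrow> real. decseq s \<and> (\<forall>j. 0 \<le> s j) \<and>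
      (\<forall>r>0. finite {j. s j = r} \<and>
             card {j. s j = r} =
               complex_vector.dim (eigenspace (abs_op T) (complex_of_real r)))) k"

definition log_mean :: "('a::complex_hilbert \<Rightarrow> 'a) \<Rightarrow> nat \<Rightarrow> real" where
  "log_mean T n = (\<Sum>k\<le>n. singular_value k T) / ln (2 + real n)"

definition dixmier_ideal :: "('a::complex_hilbert \<Rightarrow> 'a) set" where
  "dixmier_ideal = {T. compact_op T \<and> bdd_above (range (log_mean T))}"

section \<open>Generalized limits\<close>

text \<open>
  Functionals on \<open>l\<^sub>\<infinity>\<close> and \<open>L\<^sub>\<infinity>(0,\<infinity>)\<close> are functions on all sequences, respectively on all functions;
  only their values on the following sets matter.
\<close>

definition l_inf :: "(nat \<Rightarrow> real) set" where
  "l_inf = {x. bounded (range x)}"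

definition L_inf :: "(real \<Rightarrow> real) set" where
  "L_inf = {f \<in> borel_measurable (lebesgue_on {0<..}).
              \<exists>C. AE t in lebesgue_on {0<..}. \<bar>f t\<bar> \<le> C}"

definition gen_limit_seq :: "((nat \<Rightarrow> real) \<Rightarrow> real) \<Rightarrow> bool" where
  "gen_limit_seq \<omega> \<longleftrightarrow>
     (\<forall>x\<in>l_inf. \<forall>y\<in>l_inf. \<omega> (\<lambda>n. x n + y n) = \<omega> x + \<omega> y) \<and>
     (\<forall>c. \<forall>x\<in>l_inf. \<omega> (\<lambda>n. c * x n) = c * \<omega> x) \<and>
     (\<forall>x\<in>l_inf. (\<forall>n. 0 \<le> x n) \<longrightarrow> 0 \<le> \<omega> x) \<and>
     \<omega> (\<lambda>_. 1) = 1 \<and>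
     (\<forall>x L. x \<longlonglongrightarrow> L \<longrightarrow> \<omega> x = L)"

text \<open>
  Positivity is required for almost everywhere nonnegative functions.  With linearity this makes
  \<open>\<gamma>\<close> constant on classes of almost everywhere equal functions.
\<close>

definition gen_limit_fun :: "((real \<Rightarrow> real) \<Rightarrow> real) \<Rightarrow> bool" where
  "gen_limit_fun \<gamma> \<longleftrightarrow>
     (\<forall>f\<in>L_inf. \<forall>g\<in>L_inf. \<gamma> (\<lambda>t. f t + g t) = \<gamma> f + \<gamma> g) \<and>
     (\<forall>c. \<forall>f\<in>L_inf. \<gamma> (\<lambda>t. c * f t) = c * \<gamma> f) \<and>
     (\<forall>f\<in>L_inf. (AE t in lebesgue_on {0<..}. 0 \<le> f t) \<longrightarrow> 0 \<le> \<gamma> f) \<and>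
     \<gamma> (\<lambda>_. 1) = 1 \<and>
     (\<forall>f\<in>L_inf. \<forall>L. (f \<longlongrightarrow> L) at_top \<longrightarrow> \<gamma> f = L)"

definition dilation :: "nat \<Rightarrow> (nat \<Rightarrow> real) \<Rightarrow> nat \<Rightarrow> real" where
  "dilation n x = (\<lambda>k. x (k div n))"

definition dilation_invariant :: "((nat \<Rightarrow> real) \<Rightarrow> real) \<Rightarrow> bool" where
  "dilation_invariant \<omega> \<longleftrightarrow> (\<forall>x\<in>l_inf. \<forall>n\<ge>1. \<omega> (dilation n x) = \<omega> x)"

definition step_embedding :: "(nat \<Rightarrow> real) \<Rightarrow> real \<Rightarrow> real" where
  "step_embedding x = (\<lambda>t. \<Sum>n. x n * indicator {real n<..real (n + 1)} t)"

text \<open>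
  The integral is the oriented one, with opposite sign for \<open>t < 1\<close>.  It is taken with respect to
  \<open>lebesgue\<close> because elements of \<open>L\<^sub>\<infinity>\<close> need not be Borel measurable.
\<close>

definition log_cesaro :: "(real \<Rightarrow> real) \<Rightarrow> real \<Rightarrow> real" where
  "log_cesaro f = (\<lambda>t. (LINT s=ereal 1..ereal t|lebesgue. (f s / s)) / ln t)"

section \<open>Dixmier and Connes--Dixmier traces\<close>

definition dixmier_weight ::
    "((nat \<Rightarrow> real) \<Rightarrow> real) \<Rightarrow> ('a::complex_hilbert \<Rightarrow> 'a) \<Rightarrow> real" where
  "dixmier_weight \<omega> T = \<omega> (log_mean T)"

text \<open>
  The linear extension of the weight from the positive cone to the ideal.  The ideal is spanned by
  its positive elements, and for dilation invariant \<open>\<omega>\<close> the weight is additive on them, so the number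
  \<open>z\<close> exists and does not depend on the decomposition.
\<close>

definition dixmier_trace ::
    "((nat \<Rightarrow> real) \<Rightarrow> real) \<Rightarrow> ('a::complex_hilbert \<Rightarrow> 'a) \<Rightarrow> complex" where
  "dixmier_trace \<omega> T =
    (if T \<in> dixmier_ideal \<and> positive_op T then complex_of_real (dixmier_weight \<omega> T)
     else (THE z. \<exists>A B C D. {A, B, C, D} \<subseteq> dixmier_ideal \<inter> Collect positive_op \<and>
             T = (\<lambda>x. (A x - B x) + \<i> *\<^sub>C (C x - D x)) \<and>
             z = Complex (dixmier_weight \<omega> A - dixmier_weight \<omega> B)
                         (dixmier_weight \<omega> C - dixmier_weight \<omega> D)))"

definition dixmier_traces :: "(('a::complex_hilbert \<Rightarrow> 'a) \<Rightarrow> complex) set" where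
  "dixmier_traces = {dixmier_trace \<omega> | \<omega>. gen_limit_seq \<omega> \<and> dilation_invariant \<omega>}"

definition connes_dixmier_traces :: "(('a::complex_hilbert \<Rightarrow> 'a) \<Rightarrow> complex) set" where
  "connes_dixmier_traces =
    {dixmier_trace \<omega> | \<omega>. gen_limit_seq \<omega> \<and> dilation_invariant \<omega> \<and>
       (\<exists>\<gamma>. gen_limit_fun \<gamma> \<and> \<omega> = \<gamma> \<circ> log_cesaro \<circ> step_embedding)}"

end

theory Submission
  imports Defs "HOL-Real_Asymp.Real_Asymp"
begin

text \<open>
  The singular values of a positive diagonal operator are its diagonal entries, so everything
  comes down to one decreasing null sequence \<open>s\<close> and its logarithmic means
  \<open>a n = (\<Sum>k\<le>n. s k) / ln (2 + n)\<close>.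

  On the scale \<open>u = log 2 n\<close> a dilation acts as a translation by a constant, and the operator \<open>M\<close> of a
  Connes--Dixmier limit averages over the whole of \<open>[0, u]\<close>.  A dilation invariant limit may instead
  concentrate on windows of \<open>u\<close> whose lengths tend to infinity but are negligible compared with
  their positions.  The two suprema differ as soon as \<open>a\<close> is close to its largest asymptotic value
  \<open>\<kappa>\<close> on such windows while it stays at \<open>\<kappa> / 2\<close> or below on a fixed proportion of
  every \<open>[0, u]\<close>.

  The sequence used here is \<open>s k = (\<Sum>i. [k < 2 ^ 4 ^ i] 4 ^ i / 2 ^ 4 ^ i)\<close>: its \<open>i\<close>-th summand
  spreads the mass \<open>4 ^ i\<close> evenly over \<open>2 ^ 4 ^ i\<close> indices, hence releases almost all of it
  in a bounded \<open>u\<close>-distance from \<open>u = 4 ^ i\<close>.  The partial sums are therefore about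
  \<open>4 / 3 * 4 ^ i\<close> from \<open>u = 4 ^ i\<close> until shortly before \<open>u = 4 ^ (i + 1)\<close>.  At \<open>u = 4 ^ i\<close> the
  mean \<open>a\<close> is thus about \<open>\<kappa> = 4 / (3 ln 2)\<close>, which is its upper limit; it decays like \<open>1 / u\<close> and is
  at most about \<open>\<kappa> / 2\<close> for \<open>u\<close> between \<open>2 * 4 ^ i\<close> and \<open>3 * 4 ^ i\<close>.  Such intervals fill at least one
  twelfth of \<open>[0, u]\<close> when \<open>u \<ge> 3\<close>, so a Connes--Dixmier limit of \<open>a\<close> is at most \<open>\<kappa> - \<kappa> / 24\<close>
  (\<open>connes_dixmier_limit_lacunary_mean_le\<close>).

  A dilation invariant limit with value \<open>\<kappa>\<close> is a limit of averages of \<open>x (A div m)\<close> over many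
  \<open>m\<close>, taken at points \<open>A\<close> just after a jump of \<open>a\<close>
  (\<open>exists_dilation_invariant_limit_ge\<close>, \<open>lacunary_mean_large_after_jump\<close>).  On the operator side,
  the eigenspaces of the diagonal operator and the uniqueness of its positive square root
  identify the singular values (\<open>singular_value_diagonal\<close>).
\<close>

section \<open>Bounded sequences and generalized limits\<close>

lemma l_infE:
  assumes "x \<in> l_inf"
  obtains C where "\<And>k. \<bar>x k\<bar> \<le> C"
  using assms unfolding l_inf_def bounded_iff by auto

lemma l_infI: "(\<And>k. \<bar>x k\<bar> \<le> C) \<Longrightarrow> x \<in> l_inf"
  by (auto simp: l_inf_def bounded_iff)

lemma
  assumes "gen_limit_seq \<omega>" and "x \<in> l_inf"
  shows gen_limit_seq_add: "y \<in> l_inf \<Longrightarrow> \<omega> (\<lambda>n. x n + y n) = \<omega> x + \<omega> y"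
    and gen_limit_seq_scale: "\<omega> (\<lambda>n. c * x n) = c * \<omega> x"
    and gen_limit_seq_nonneg: "(\<And>n. 0 \<le> x n) \<Longrightarrow> 0 \<le> \<omega> x"
  using assms unfolding gen_limit_seq_def by simp_all

lemma gen_limit_seq_tendsto: "gen_limit_seq \<omega> \<Longrightarrow> x \<longlonglongrightarrow> L \<Longrightarrow> \<omega> x = L"
  unfolding gen_limit_seq_def by simp

lemma l_inf_add: "x \<in> l_inf \<Longrightarrow> y \<in> l_inf \<Longrightarrow> (\<lambda>n. x n + y n) \<in> l_inf"
  using bounded_plus_comp[of x UNIV y] by (simp add: l_inf_def)

lemma l_inf_scale: "x \<in> l_inf \<Longrightarrow> (\<lambda>n. c * x n) \<in> l_inf"
  using bounded_scaling[of "range x" c] by (simp add: l_inf_def image_image)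

lemma gen_limit_seq_mono:
  assumes \<omega>: "gen_limit_seq \<omega>" and x: "x \<in> l_inf" and y: "y \<in> l_inf" and le: "\<And>n. x n \<le> y n"
  shows "\<omega> x \<le> \<omega> y"
proof -
  have nx: "(\<lambda>n. - 1 * x n) \<in> l_inf" by (rule l_inf_scale[OF x])
  have "0 \<le> \<omega> (\<lambda>n. y n + - 1 * x n)"
    by (rule gen_limit_seq_nonneg[OF \<omega> l_inf_add[OF y nx]]) (use le in simp)
  then show ?thesis
    by (simp only: gen_limit_seq_add[OF \<omega> y nx] gen_limit_seq_scale[OF \<omega> x])
qed

lemma
  assumes "gen_limit_fun \<gamma>" and "f \<in> L_inf"
  shows gen_limit_fun_add: "g \<in> L_inf \<Longrightarrow> \<gamma> (\<lambda>t. f t + g t) = \<gamma> f + \<gamma> g"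
    and gen_limit_fun_nonneg: "(\<And>t. 0 \<le> f t) \<Longrightarrow> 0 \<le> \<gamma> f"
    and gen_limit_fun_tendsto: "(f \<longlongrightarrow> L) at_top \<Longrightarrow> \<gamma> f = L"
  using assms unfolding gen_limit_fun_def by (simp_all add: AE_I2)

text \<open>
  The defect \<open>max 0 (c - f t)\<close> vanishes for large \<open>t\<close>, so adding it makes the inequality hold everywhere
  without changing the limit.
\<close>
lemma gen_limit_fun_ge:
  assumes \<gamma>: "gen_limit_fun \<gamma>" and f: "f \<in> L_inf" and ev: "eventually (\<lambda>t. c \<le> f t) at_top"
  shows "c \<le> \<gamma> f"
proof -
  define g where "g t = max 0 (c - f t)" for t
  have f_meas [measurable]: "f \<in> borel_measurable (lebesgue_on {0<..})"
    using f by (simp add: L_inf_def)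
  obtain C where C: "AE t in lebesgue_on {0<..}. \<bar>f t\<bar> \<le> C" using f by (auto simp: L_inf_def)
  have "g \<in> L_inf"
    unfolding L_inf_def
  proof (intro CollectI conjI exI)
    show "g \<in> borel_measurable (lebesgue_on {0<..})" unfolding g_def by measurable
    show "AE t in lebesgue_on {0<..}. \<bar>g t\<bar> \<le> \<bar>c\<bar> + C"
      using C by eventually_elim (auto simp: g_def)
  qed
  have const: "(\<lambda>_. k) \<in> L_inf" for k by (auto simp: L_inf_def)
  have add: "(\<lambda>t. u t + v t) \<in> L_inf" if uv: "u \<in> L_inf" "v \<in> L_inf" for u v
  proof -
    obtain U V where "AE t in lebesgue_on {0<..}. \<bar>u t\<bar> \<le> U" "AE t in lebesgue_on {0<..}. \<bar>v t\<bar> \<le> V"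
      using uv by (auto simp: L_inf_def)
    then have "AE t in lebesgue_on {0<..}. \<bar>u t + v t\<bar> \<le> U + V" by eventually_elim auto
    then show ?thesis using uv unfolding L_inf_def by (auto intro: borel_measurable_add)
  qed
  have "(g \<longlongrightarrow> 0) at_top"
    by (rule tendsto_eventually) (use ev in \<open>eventually_elim, simp add: g_def\<close>)
  then have "\<gamma> g = 0" by (rule gen_limit_fun_tendsto[OF \<gamma> \<open>g \<in> L_inf\<close>])
  moreover have "\<gamma> (\<lambda>_. - c) = - c"
    by (rule gen_limit_fun_tendsto[OF \<gamma> const]) (rule tendsto_const)
  moreover have "\<gamma> (\<lambda>t. (f t + g t) + - c) = \<gamma> f + \<gamma> g + \<gamma> (\<lambda>_. - c)"
    by (simp only: gen_limit_fun_add[OF \<gamma>] add f \<open>g \<in> L_inf\<close> const)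
  moreover have "0 \<le> \<gamma> (\<lambda>t. (f t + g t) + - c)"
    by (rule gen_limit_fun_nonneg[OF \<gamma> add[OF add[OF f \<open>g \<in> L_inf\<close>] const]]) (simp add: g_def)
  ultimately show ?thesis by linarith
qed

section \<open>Dilation invariant limits with a prescribed large value\<close>

text \<open>
  This filter plays the part of a free ultrafilter.  Evaluation at \<open>n\<close> is a point of the product of
  the compact closures of the ranges of all bounded sequences.  By Tychonoff's theorem these points
  have a cluster point as \<open>n\<close> grows.  The filter is generated by the tails of the natural numbers and
  the sets of all \<open>n\<close> whose evaluation lies in a given neighbourhood of that cluster point.
\<close>
lemma exists_universal_filter:
  "\<exists>F :: nat filter. F \<noteq> bot \<and> F \<le> sequentially \<and>
     (\<forall>x\<in>l_inf. \<exists>L. (x \<longlongrightarrow> L) F)"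
proof -
  define W :: "nat \<Rightarrow> (nat \<Rightarrow> real) \<Rightarrow> real" where "W n x = (if x \<in> l_inf then x n else 0)" for n x
  define B :: "(nat \<Rightarrow> real) \<Rightarrow> real set" where "B x = closure (range (\<lambda>n. W n x))" for x
  \<comment> \<open>Unbounded sequences are sent to 0, which keeps all factors of the product compact.\<close>
  define K where "K = Pi\<^sub>E UNIV B"
  have "compact (B x)" for x
  proof (cases "x \<in> l_inf")
    case True
    then show ?thesis by (simp add: B_def W_def l_inf_def compact_closure)
  qed (simp add: B_def W_def)
  then have "compact K"
    unfolding K_def by (metis compactin_euclidean_iff compactin_PiE euclidean_product_topology)
  moreover have "filtermap W sequentially \<noteq> bot"
    by (simp add: filtermap_bot_iff)
  moreover have "eventually (\<lambda>f. f \<in> K) (filtermap W sequentially)"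
    unfolding eventually_filtermap K_def B_def
    by (intro always_eventually) (auto simp: PiE_def intro: closure_subset[THEN subsetD])
  ultimately obtain w where w: "inf (nhds w) (filtermap W sequentially) \<noteq> bot"
    unfolding compact_filter by blast
  define F where "F = inf (filtercomap W (nhds w)) sequentially"
  have "F \<noteq> bot"
  proof
    assume "F = bot"
    then have "eventually (\<lambda>_. False) F" by simp
    then obtain P Q where "eventually P (filtercomap W (nhds w))" "eventually Q sequentially"
      and PQ: "\<And>n. P n \<Longrightarrow> Q n \<Longrightarrow> False"
      unfolding F_def eventually_inf by blast
    then obtain R where R: "eventually R (nhds w)" "\<And>n. R (W n) \<Longrightarrow> P n"
      unfolding eventually_filtercomap by blast
    have "eventually (\<lambda>f. \<not> R f) (filtermap W sequentially)"
      unfolding eventually_filtermap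
      using \<open>eventually Q sequentially\<close> by eventually_elim (use PQ R in blast)
    then have "eventually (\<lambda>_. False) (inf (nhds w) (filtermap W sequentially))"
      unfolding eventually_inf using R(1) by blast
    then show False using w by (simp add: eventually_False)
  qed
  moreover have "(x \<longlongrightarrow> w x) F" if "x \<in> l_inf" for x
  proof -
    have "((\<lambda>f. f x) \<longlongrightarrow> w x) (nhds w)"
      using continuous_on_product_coordinates[of x]
        tendsto_at_iff_tendsto_nhds[of "\<lambda>f. f x" w]
      by (metis UNIV_I continuous_on_def)
    then have "((\<lambda>n. W n x) \<longlongrightarrow> w x) (filtercomap W (nhds w))"
      by (rule filterlim_compose[OF _ filterlim_filtercomap])
    moreover have "F \<le> filtercomap W (nhds w)" by (simp add: F_def)
    ultimately have "((\<lambda>n. W n x) \<longlongrightarrow> w x) F"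
      using filterlim_mono by blast
    then show ?thesis using that by (simp add: W_def)
  qed
  moreover have "F \<le> sequentially" by (simp add: F_def)
  ultimately show ?thesis by blast
qed

text \<open>
  The product over \<open>1 \<le> r \<le> q\<close> of the averages of the dilations by \<open>r ^ 0, \<dots>, r ^ (N - 1)\<close>.  The multiplicative
  semigroup of the positive integers is commutative, so such products are asymptotically invariant
  under each dilation; this takes the place of a Folner sequence.
\<close>
primrec dilation_average :: "nat \<Rightarrow> nat \<Rightarrow> (nat \<Rightarrow> real) \<Rightarrow> nat \<Rightarrow> real" where
  "dilation_average N 0 x = x"
| "dilation_average N (Suc q) x =
     (\<lambda>k. (\<Sum>i<N. dilation_average N q x (k div Suc q ^ i)) / real N)"

lemma dilation_average_add:
  "dilation_average N q (\<lambda>k. x k + y k) =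
     (\<lambda>k. dilation_average N q x k + dilation_average N q y k)"
  by (induction q) (simp_all add: sum.distrib add_divide_distrib)

lemma dilation_average_scale:
  "dilation_average N q (\<lambda>k. c * x k) = (\<lambda>k. c * dilation_average N q x k)"
  by (induction q) (simp_all add: sum_distrib_left)

text \<open>
  Unfolded, the value at \<open>k\<close> is a convex combination of the numbers \<open>x (k div m)\<close> with \<open>m\<close> a product of
  powers \<open>r ^ i\<close>, where \<open>i < N\<close> and \<open>1 \<le> r \<le> q\<close>, because \<open>k div a div b = k div (a * b)\<close>.
\<close>
lemma dilation_average_between:
  assumes "N > 0" and "\<And>m. 1 \<le> m \<Longrightarrow> m \<le> (\<Prod>r\<in>{1..q}. r ^ N) \<Longrightarrow> l \<le> x (k div m) \<and> x (k div m) \<le> u"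
  shows "l \<le> dilation_average N q x k \<and> dilation_average N q x k \<le> u"
  using assms(2)
proof (induction q arbitrary: k)
  case 0
  from 0[of 1] show ?case by simp
next
  case (Suc q)
  have "l \<le> dilation_average N q x (k div Suc q ^ i) \<and>
        dilation_average N q x (k div Suc q ^ i) \<le> u" if "i < N" for i
  proof (rule Suc.IH)
    fix m assume m: "1 \<le> m" "m \<le> (\<Prod>r\<in>{1..q}. r ^ N)"
    have "Suc q ^ i * m \<le> Suc q ^ N * (\<Prod>r\<in>{1..q}. r ^ N)"
      using m that by (intro mult_mono power_increasing) auto
    then have "Suc q ^ i * m \<le> (\<Prod>r\<in>{1..Suc q}. r ^ N)"
      by (simp add: mult.commute)
    moreover have "1 \<le> Suc q ^ i * m" using m by simp
    ultimately show "l \<le> x (k div Suc q ^ i div m) \<and> x (k div Suc q ^ i div m) \<le> u"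
      using Suc.prems[of "Suc q ^ i * m"] by (simp add: div_mult2_eq)
  qed
  then have "(\<Sum>i<N. l) \<le> (\<Sum>i<N. dilation_average N q x (k div Suc q ^ i))"
    "(\<Sum>i<N. dilation_average N q x (k div Suc q ^ i)) \<le> (\<Sum>i<N. u)"
    by (intro sum_mono; simp)+
  then show ?case using \<open>N > 0\<close> by (simp add: field_simps)
qed

lemma dilation_average_dilation:
  "dilation_average N q (dilation m x) = dilation m (dilation_average N q x)"
  by (induction q) (simp_all add: dilation_def div_mult2_eq[symmetric] mult.commute fun_eq_iff)

text \<open>
  The factor for \<open>r = m\<close> turns the difference into a telescoping sum, of which only two of the \<open>N\<close>
  summands survive.  The other factors are averages of commuting operators, so they preserve the bound.
\<close>
lemma dilation_average_almost_invariant: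
  assumes "N > 0" "1 \<le> m" "m \<le> q" and C: "\<And>k. \<bar>x k\<bar> \<le> C"
  shows "\<bar>dilation_average N q (dilation m x) k - dilation_average N q x k\<bar> \<le> 2 * C / real N"
  using assms(3)
proof (induction q arbitrary: k)
  case 0
  then show ?case using \<open>1 \<le> m\<close> by simp
next
  case (Suc q)
  let ?P = "dilation_average N q"
  show ?case
  proof (cases "m = Suc q")
    case True
    let ?y = "\<lambda>i. ?P x (k div Suc q ^ i)"
    have y: "\<bar>?y i\<bar> \<le> C" for i
      using dilation_average_between[of N q "- C" x "k div Suc q ^ i" C] C \<open>N > 0\<close>
      by (simp add: abs_le_iff minus_le_iff)
    have "(\<Sum>i<N. ?P (dilation m x) (k div Suc q ^ i)) - (\<Sum>i<N. ?y i)
        = (\<Sum>i<N. ?y (Suc i) - ?y i)"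
      unfolding dilation_average_dilation
      by (simp add: dilation_def True div_mult2_eq[symmetric] sum_subtractf mult.commute)
    also have "\<dots> = ?y N - ?y 0"
      by (rule sum_lessThan_telescope)
    finally have "dilation_average N (Suc q) (dilation m x) k - dilation_average N (Suc q) x k
        = (?y N - ?y 0) / real N"
      by (simp add: diff_divide_distrib[symmetric])
    moreover have "\<bar>?y N - ?y 0\<bar> \<le> 2 * C" using y[of N] y[of 0] by linarith
    ultimately show ?thesis using \<open>N > 0\<close> by (simp add: divide_right_mono)
  next
    case False
    then have IH: "\<bar>?P (dilation m x) j - ?P x j\<bar> \<le> 2 * C / real N" for j
      using Suc by simp
    have "dilation_average N (Suc q) (dilation m x) k - dilation_average N (Suc q) x k
        = (\<Sum>i<N. ?P (dilation m x) (k div Suc q ^ i) - ?P x (k div Suc q ^ i)) / real N"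
      by (simp add: sum_subtractf diff_divide_distrib)
    also have "\<bar>\<dots>\<bar> \<le> (\<Sum>i<N. 2 * C / real N) / real N"
      unfolding abs_divide using IH
      by (intro divide_mono order_trans[OF sum_abs] sum_mono) (auto simp: \<open>N > 0\<close>)
    also have "\<dots> = 2 * C / real N" using \<open>N > 0\<close> by simp
    finally show ?thesis .
  qed
qed

text \<open>
  The functional is a limit of averages of dilations, evaluated at indices \<open>A\<close> where \<open>x (A div m)\<close> is
  almost \<open>\<kappa>\<close> for every \<open>m\<close> that occurs in the average.
\<close>
lemma exists_dilation_invariant_limit_ge:
  assumes x: "x \<in> l_inf"
    and large: "\<And>M \<epsilon> n. \<epsilon> > 0 \<Longrightarrow> \<exists>A\<ge>n. \<forall>m. 1 \<le> m \<longrightarrow> m \<le> M \<longrightarrow> x (A div m) \<ge> \<kappa> - \<epsilon>"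
  shows "\<exists>\<omega>. gen_limit_seq \<omega> \<and> dilation_invariant \<omega> \<and> \<omega> x \<ge> \<kappa>"
proof -
  define M where "M N = (\<Prod>r\<in>{1..N}. r ^ N)" for N :: nat
  \<comment> \<open>The bound \<open>A \<ge> N * M N\<close> makes all \<open>A div m\<close> tend to infinity, so ordinary limits are preserved.\<close>
  have "\<exists>A\<ge>N * M N. \<forall>m. 1 \<le> m \<longrightarrow> m \<le> M N \<longrightarrow> x (A div m) \<ge> \<kappa> - 1 / real (Suc N)" for N
    by (rule large) simp
  then obtain A where A: "\<And>N. A N \<ge> N * M N"
    and A': "\<And>N m. 1 \<le> m \<Longrightarrow> m \<le> M N \<Longrightarrow> x (A N div m) \<ge> \<kappa> - 1 / real (Suc N)"
    by metis
  define P where "P y N = dilation_average N N y (A N)" for y N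
  have P_between: "l \<le> P y N \<and> P y N \<le> u"
    if "N > 0" "\<And>m. 1 \<le> m \<Longrightarrow> m \<le> M N \<Longrightarrow> l \<le> y (A N div m) \<and> y (A N div m) \<le> u" for l y N u
    unfolding P_def using that by (intro dilation_average_between) (auto simp: M_def)
  have P_l_inf: "P y \<in> l_inf" if y: "y \<in> l_inf" for y
  proof -
    obtain C where C: "\<And>k. \<bar>y k\<bar> \<le> C"
      using y by (rule l_infE) blast
    have "\<bar>P y N\<bar> \<le> C" for N
    proof (cases "N = 0")
      case False
      then show ?thesis using P_between[of N "- C" y C] C by (simp add: abs_le_iff minus_le_iff)
    qed (simp add: P_def C)
    then show ?thesis unfolding l_inf_def bounded_iff by auto
  qed
  obtain F :: "nat filter" where F: "F \<noteq> bot" "F \<le> sequentially"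
    and conv: "\<And>y. y \<in> l_inf \<Longrightarrow> \<exists>L. (y \<longlongrightarrow> L) F"
    using exists_universal_filter by blast
  define \<omega> where "\<omega> y = Lim F (P y)" for y
  have lim: "(P y \<longlongrightarrow> \<omega> y) F" if "y \<in> l_inf" for y
    using conv[OF P_l_inf[OF that]] tendsto_Lim[OF F(1)] unfolding \<omega>_def by metis
  have eqI: "\<omega> y = L" if "P y \<longlonglongrightarrow> L" for y L
    unfolding \<omega>_def by (rule tendsto_Lim[OF F(1)]) (rule filterlim_mono[OF that order_refl F(2)])
  have geI: "L \<le> \<omega> y" if "y \<in> l_inf" "eventually (\<lambda>N. L - 1 / real (Suc N) \<le> P y N) sequentially" for y L
  proof (rule tendsto_le[OF F(1) lim[OF that(1)]])
    have "(\<lambda>N. L - 1 / real (Suc N)) \<longlonglongrightarrow> L - 0"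
      using LIMSEQ_inverse_real_of_nat by (intro tendsto_intros) (simp add: field_simps)
    then show "((\<lambda>N. L - 1 / real (Suc N)) \<longlongrightarrow> L) F"
      using filterlim_mono[OF _ order_refl F(2)] by fastforce
    show "eventually (\<lambda>N. L - 1 / real (Suc N) \<le> P y N) F"
      using that(2) F(2) by (simp add: le_filter_def)
  qed
  have "gen_limit_seq \<omega>"
    unfolding gen_limit_seq_def
  proof (intro conjI ballI allI impI)
    fix y z assume y: "y \<in> l_inf" and z: "z \<in> l_inf"
    have "P (\<lambda>n. y n + z n) = (\<lambda>N. P y N + P z N)"
      by (simp add: P_def dilation_average_add fun_eq_iff)
    then show "\<omega> (\<lambda>n. y n + z n) = \<omega> y + \<omega> z"
      using tendsto_add[OF lim[OF y] lim[OF z]] lim[OF l_inf_add[OF y z]]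
      using tendsto_unique[OF F(1)] by metis
  next
    fix c y assume y: "y \<in> l_inf"
    have "P (\<lambda>n. c * y n) = (\<lambda>N. c * P y N)"
      by (simp add: P_def dilation_average_scale fun_eq_iff)
    then show "\<omega> (\<lambda>n. c * y n) = c * \<omega> y"
      using tendsto_mult[OF tendsto_const lim[OF y]] lim[OF l_inf_scale[OF y]]
      using tendsto_unique[OF F(1)] by metis
  next
    fix y :: "nat \<Rightarrow> real" assume y: "y \<in> l_inf" "\<forall>n. 0 \<le> y n"
    obtain C where C: "\<And>k. \<bar>y k\<bar> \<le> C"
      using y(1) by (rule l_infE) blast
    show "0 \<le> \<omega> y"
    proof (rule geI[OF y(1)])
      show "eventually (\<lambda>N. 0 - 1 / real (Suc N) \<le> P y N) sequentially"
        using eventually_gt_at_top[of 0]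
      proof eventually_elim
        case (elim N)
        then have "0 \<le> P y N" using P_between[of N 0 y C] C y(2) abs_le_D1 by blast
        then show ?case by (smt (verit) divide_nonneg_nonneg of_nat_0_le_iff)
      qed
    qed
  next
    have "eventually (\<lambda>N. P (\<lambda>_. 1) N = 1) sequentially"
      using eventually_gt_at_top[of 0]
    proof eventually_elim
      case (elim N)
      then show ?case using P_between[of N 1 "\<lambda>_. 1" 1] by simp
    qed
    then show "\<omega> (\<lambda>_. 1) = 1" by (intro eqI tendsto_eventually)
  next
    fix y and L :: real assume y: "y \<longlonglongrightarrow> L"
    show "\<omega> y = L"
    proof (rule eqI, rule LIMSEQ_I)
      fix r :: real assume "r > 0"
      then obtain n0 where n0: "\<And>n. n \<ge> n0 \<Longrightarrow> \<bar>y n - L\<bar> < r / 2"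
        using LIMSEQ_D[OF y, of "r / 2"] by auto
      show "\<exists>no. \<forall>N\<ge>no. norm (P y N - L) < r"
      proof (intro exI allI impI)
        fix N assume N: "N \<ge> Suc n0"
        have "L - r / 2 \<le> P y N \<and> P y N \<le> L + r / 2"
        proof (rule P_between)
          fix m assume m: "1 \<le> m" "m \<le> M N"
          have "N * m \<le> A N" using A[of N] m by (meson le_trans mult_le_mono2)
          then have "N \<le> A N div m" using m by (simp add: less_eq_div_iff_mult_less_eq)
          then have "\<bar>y (A N div m) - L\<bar> < r / 2" using n0 N by simp
          then show "L - r / 2 \<le> y (A N div m) \<and> y (A N div m) \<le> L + r / 2"
            by linarith
        qed (use N in simp)
        then show "norm (P y N - L) < r" using \<open>r > 0\<close> by (auto simp: abs_less_iff)
      qed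
    qed
  qed
  moreover have "dilation_invariant \<omega>"
    unfolding dilation_invariant_def
  proof (intro ballI allI impI)
    fix y :: "nat \<Rightarrow> real" and m :: nat assume y: "y \<in> l_inf" and m: "m \<ge> 1"
    obtain C where C: "\<And>k. \<bar>y k\<bar> \<le> C"
      using y by (rule l_infE) blast
    have "bounded (range (dilation m y))"
      using y by (auto simp: l_inf_def dilation_def intro: bounded_subset)
    then have y': "dilation m y \<in> l_inf" by (simp add: l_inf_def)
    have "(\<lambda>N. P (dilation m y) N - P y N) \<longlonglongrightarrow> 0"
    proof (rule tendsto_rabs_zero_cancel, rule tendsto_sandwich[OF _ _ tendsto_const])
      show "(\<lambda>N. 2 * C / real N) \<longlonglongrightarrow> 0" by real_asymp
      show "eventually (\<lambda>N. \<bar>P (dilation m y) N - P y N\<bar> \<le> 2 * C / real N) sequentially"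
        using eventually_ge_at_top[of m]
      proof eventually_elim
        case (elim N)
        then show ?case unfolding P_def
          by (intro dilation_average_almost_invariant) (use m C in auto)
      qed
    qed simp
    then have "((\<lambda>N. P (dilation m y) N - P y N) \<longlongrightarrow> 0) F"
      using filterlim_mono[OF _ order_refl F(2)] by blast
    moreover have "((\<lambda>N. P (dilation m y) N - P y N) \<longlongrightarrow> \<omega> (dilation m y) - \<omega> y) F"
      by (intro tendsto_diff lim y y')
    ultimately show "\<omega> (dilation m y) = \<omega> y"
      using tendsto_unique[OF F(1)] by fastforce
  qed
  moreover have "\<kappa> \<le> \<omega> x"
  proof (rule geI[OF x])
    obtain C where C: "\<And>k. \<bar>x k\<bar> \<le> C"
      using x by (rule l_infE) blast
    show "eventually (\<lambda>N. \<kappa> - 1 / real (Suc N) \<le> P x N) sequentially"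
      using eventually_gt_at_top[of 0]
    proof eventually_elim
      case (elim N)
      then show ?case
        using P_between[of N "\<kappa> - 1 / real (Suc N)" x C] A' C abs_le_D1 by blast
    qed
  qed
  ultimately show ?thesis by blast
qed

section \<open>Logarithmic averages of step functions\<close>

text \<open>
  The measure \<open>ds / s\<close> of an interval is the difference of the logarithms of its endpoints.
\<close>
lemma LBINT_between_logs:
  fixes g :: "real \<Rightarrow> real"
  assumes [measurable]: "g \<in> borel_measurable borel" and ab: "0 < a" "a \<le> b" and l: "0 \<le> l"
    and g: "\<And>s. a < s \<Longrightarrow> s < b \<Longrightarrow> l / s \<le> g s \<and> g s \<le> u / s"
  shows "interval_lebesgue_integrable lborel (ereal a) (ereal b) g"
    and "l * (ln b - ln a) \<le> (LBINT s=ereal a..ereal b. g s)"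
    and "(LBINT s=ereal a..ereal b. g s) \<le> u * (ln b - ln a)"
proof -
  have const: "set_integrable lborel {a<..<b} (\<lambda>s. c / s)" for c :: real
  proof (rule set_integrable_subset)
    show "set_integrable lborel {a..b} (\<lambda>s. c / s)"
      by (rule borel_integrable_atLeastAtMost') (use ab in \<open>auto intro!: continuous_intros\<close>)
  qed auto
  have const_eq: "(LBINT s:{a<..<b}. c / s) = c * (ln b - ln a)" for c :: real
  proof -
    have "(LBINT s=a..b. c / s) = c * ln b - c * ln a"
      by (rule interval_integral_FTC_finite)
         (use ab in \<open>auto intro!: continuous_intros derivative_eq_intros
            simp: has_real_derivative_iff_has_vector_derivative[symmetric] divide_inverse\<close>)
    then show ?thesis using ab by (simp add: interval_lebesgue_integral_def right_diff_distrib)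
  qed
  have int: "set_integrable lborel {a<..<b} g"
  proof (rule set_integrable_bound[OF const[of u]])
    show "set_borel_measurable lborel {a<..<b} g" by (simp add: set_borel_measurable_def)
    show "AE s in lborel. s \<in> {a<..<b} \<longrightarrow> norm (g s) \<le> norm (u / s)"
    proof (intro AE_I2 impI)
      fix s assume s: "s \<in> {a<..<b}"
      then have "0 \<le> l / s" using l ab by simp
      moreover have "l / s \<le> g s \<and> g s \<le> u / s" using s by (intro g) auto
      ultimately show "norm (g s) \<le> norm (u / s)" unfolding real_norm_def by linarith
    qed
  qed
  then show "interval_lebesgue_integrable lborel (ereal a) (ereal b) g"
    using ab by (simp add: interval_lebesgue_integrable_def)
  show "l * (ln b - ln a) \<le> (LBINT s=ereal a..ereal b. g s)"
    using set_integral_mono[OF const[of l] int] g ab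
    by (simp add: interval_lebesgue_integral_def const_eq)
  show "(LBINT s=ereal a..ereal b. g s) \<le> u * (ln b - ln a)"
    using set_integral_mono[OF int const[of u]] g ab
    by (simp add: interval_lebesgue_integral_def const_eq)
qed

lemma step_embedding_eq:
  assumes "real n < s" "s \<le> real n + 1"
  shows "step_embedding x s = x n"
proof -
  have "x m * indicator {real m<..real (m + 1)} s = (if m = n then x n else 0)" for m
    using assms by (auto simp: indicator_def)
  then show ?thesis
    unfolding step_embedding_def using sums_unique[OF sums_single[of n "\<lambda>_. x n"]] by simp
qed

lemma step_embedding_in_range:
  assumes "0 < s"
  obtains n where "step_embedding x s = x n"
proof -
  define n where "n = nat (\<lceil>s\<rceil> - 1)"
  have "real n < s" "s \<le> real n + 1" using assms unfolding n_def by linarith+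
  then show thesis using step_embedding_eq that by blast
qed

lemma borel_measurable_step_embedding [measurable]: "step_embedding x \<in> borel_measurable borel"
  unfolding step_embedding_def by measurable

definition log_integral :: "(real \<Rightarrow> real) \<Rightarrow> real \<Rightarrow> real \<Rightarrow> real" where
  "log_integral f a b = (LBINT s=ereal a..ereal b. f s / s)"

text \<open>
  For Borel functions the integral with respect to the completed measure is the one with respect to
  \<open>lborel\<close>, to which the fundamental theorem and the additivity of oriented integrals apply.
\<close>
lemma log_cesaro_eq:
  assumes [measurable]: "f \<in> borel_measurable borel"
  shows "log_cesaro f t = log_integral f 1 t / ln t"
  unfolding log_cesaro_def log_integral_def interval_lebesgue_integral_def set_lebesgue_integral_def
  by (simp add: integral_completion)

lemma log_integral_bounds:
  assumes [measurable]: "f \<in> borel_measurable borel" and f: "\<And>s. 0 < s \<Longrightarrow> 0 \<le> f s \<and> f s \<le> 1"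
    and ab: "0 < a" "a \<le> b"
  shows "0 \<le> log_integral f a b" and "log_integral f a b \<le> ln b - ln a"
proof -
  have "0 / s \<le> f s / s \<and> f s / s \<le> 1 / s" if "a < s" "s < b" for s
    using f[of s] that ab by (auto intro: divide_right_mono)
  then show "0 \<le> log_integral f a b" "log_integral f a b \<le> ln b - ln a"
    using LBINT_between_logs[of "\<lambda>s. f s / s" a b 0 1] ab by (auto simp: log_integral_def)
qed

lemma log_integral_sum:
  assumes [measurable]: "f \<in> borel_measurable borel" and f: "\<And>s. 0 < s \<Longrightarrow> 0 \<le> f s \<and> f s \<le> 1"
    and pos: "0 < a" "0 < b" "0 < c"
  shows "log_integral f a b + log_integral f b c = log_integral f a c"
  unfolding log_integral_def
proof (rule interval_integral_sum)
  define p where "p = min a (min b c)"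
  define q where "q = max a (max b c)"
  have pq: "0 < p" "p \<le> q" using pos by (auto simp: p_def q_def)
  have "0 / s \<le> f s / s \<and> f s / s \<le> 1 / s" if "p < s" "s < q" for s
    using f[of s] that pq by (auto intro: divide_right_mono)
  then have "interval_lebesgue_integrable lborel (ereal p) (ereal q) (\<lambda>s. f s / s)"
    using LBINT_between_logs(1)[of "\<lambda>s. f s / s" p q 0 1] pq by simp
  then show "interval_lebesgue_integrable lborel (min (ereal a) (min (ereal b) (ereal c)))
      (max (ereal a) (max (ereal b) (ereal c))) (\<lambda>s. f s / s)"
    by (simp add: p_def q_def)
qed

lemma log_integral_swap: "log_integral f b a = - log_integral f a b"
  unfolding log_integral_def by (rule interval_integral_endpoints_reverse)

text \<open>
  The integral from \<open>1\<close> to \<open>t\<close> is monotone in \<open>t\<close>, hence measurable, and at most \<open>\<bar>ln t\<bar>\<close> in absolute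
  value.
\<close>
lemma log_cesaro_in_L_inf:
  assumes [measurable]: "f \<in> borel_measurable borel" and f: "\<And>s. 0 < s \<Longrightarrow> 0 \<le> f s \<and> f s \<le> 1"
  shows "log_cesaro f \<in> L_inf"
proof -
  let ?I = "log_integral f 1"
  have "mono_on {0<..} ?I"
  proof (rule mono_onI)
    fix a b :: real assume "a \<in> {0<..}" "b \<in> {0<..}" "a \<le> b"
    then show "?I a \<le> ?I b"
      using log_integral_sum[OF assms, of 1 a b] log_integral_bounds(1)[OF assms, of a b] by simp
  qed
  then have "?I \<in> borel_measurable (restrict_space borel {0<..})"
    by (rule borel_measurable_mono_on_fnc)
  then have "(\<lambda>t. ?I t / ln t) \<in> borel_measurable (restrict_space borel {0<..})"
    by (intro borel_measurable_divide) (auto intro: measurable_restrict_space1)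
  then have "(\<lambda>t. indicator {0<..} t *\<^sub>R (?I t / ln t)) \<in> borel_measurable lebesgue"
    by (subst (asm) borel_measurable_restrict_space_iff) (auto intro: measurable_completion)
  then have "log_cesaro f \<in> borel_measurable (lebesgue_on {0<..})"
    by (subst borel_measurable_restrict_space_iff) (auto simp: log_cesaro_eq)
  moreover have "\<bar>log_cesaro f t\<bar> \<le> 1" if "0 < t" for t
  proof -
    have "\<bar>?I t\<bar> \<le> \<bar>ln t\<bar>"
    proof (cases "1 \<le> t")
      case True
      then show ?thesis using log_integral_bounds[OF assms, of 1 t] by simp
    next
      case False
      then show ?thesis
        using log_integral_bounds[OF assms, of t 1] log_integral_swap[of f t 1] that by simp
    qed
    then show ?thesis by (auto simp: log_cesaro_eq divide_le_eq_1)
  qed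
  then have "AE t in lebesgue_on {0<..}. \<bar>log_cesaro f t\<bar> \<le> 1"
    by (intro AE_I2) auto
  ultimately show ?thesis unfolding L_inf_def by blast
qed

section \<open>A sequence whose partial sums jump\<close>

definition lacunary_seq :: "nat \<Rightarrow> real" where
  "lacunary_seq k = (\<Sum>i. if k < 2 ^ 4 ^ i then 4 ^ i / 2 ^ 4 ^ i else 0)"

text \<open>
  The partial sums of \<open>lacunary_seq\<close> as a function of the number of summands, interpolated to real
  arguments; see \<open>sum_lacunary_seq\<close>.
\<close>
definition lacunary_sum :: "real \<Rightarrow> real" where
  "lacunary_sum x = (\<Sum>i. 4 ^ i * min 1 (x / 2 ^ 4 ^ i))"

text \<open>
  This makes the series of weights \<open>4 ^ i / 2 ^ 4 ^ i\<close> converge geometrically.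
\<close>
lemma square_le_two_power: "((4::real) ^ i)\<^sup>2 \<le> 2 ^ 4 ^ i"
proof (cases i)
  case (Suc j)
  define y where "y = (4::nat) ^ j"
  have "y < 2 ^ y" by (rule less_exp)
  then have "y + 1 \<le> 2 ^ y" by (simp add: Suc_leI)
  then have "(y + 1) ^ 4 \<le> (2 ^ y) ^ 4" by (rule power_mono) simp
  \<comment> \<open>Both sides are squares; the roots compare by the inequality of the means.\<close>
  moreover have "(4 * y)\<^sup>2 \<le> (y + 1) ^ 4"
  proof -
    have "4 * y \<le> (y + 1)\<^sup>2"
      by (cases y) (simp_all add: power2_eq_square)
    then have "(4 * y)\<^sup>2 \<le> ((y + 1)\<^sup>2)\<^sup>2" by (rule power_mono) simp
    then show ?thesis by (simp only: power_mult[symmetric]) simp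
  qed
  ultimately have "(4 * y)\<^sup>2 \<le> 2 ^ (4 * y)"
    by (simp only: power_mult[symmetric] mult.commute[of y])
  then have "real ((4 * y)\<^sup>2) \<le> real (2 ^ (4 * y))" by (simp only: of_nat_le_iff)
  then show ?thesis by (simp add: y_def Suc)
qed simp

lemma lacunary_weight_le: "(4::real) ^ i / 2 ^ 4 ^ i \<le> (1 / 4) ^ i"
proof -
  have "(4::real) ^ i * 4 ^ i \<le> 2 ^ 4 ^ i"
    using square_le_two_power[of i] unfolding power2_eq_square .
  then show ?thesis by (simp add: field_simps)
qed

lemma summable_lacunary_weight: "summable (\<lambda>i. (4::real) ^ i / 2 ^ 4 ^ i)"
  by (rule summable_comparison_test'[where g = "\<lambda>i. (1 / 4) ^ i" and N = 0])
     (use lacunary_weight_le in \<open>auto intro: summable_geometric\<close>)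

lemma summable_lacunary_seq:
  fixes k :: nat
  shows "summable (\<lambda>i. if k < 2 ^ 4 ^ i then 4 ^ i / 2 ^ 4 ^ i else (0::real))"
  by (rule summable_comparison_test'[OF summable_lacunary_weight, where N = 0]) auto

lemma summable_lacunary_sum:
  assumes "0 \<le> x"
  shows "summable (\<lambda>i. 4 ^ i * min 1 (x / 2 ^ 4 ^ i) :: real)"
proof (rule summable_comparison_test'[where N = 0])
  show "summable (\<lambda>i. x * (4 ^ i / 2 ^ 4 ^ i))"
    by (intro summable_mult summable_lacunary_weight)
  show "norm (4 ^ i * min 1 (x / 2 ^ 4 ^ i)) \<le> x * (4 ^ i / 2 ^ 4 ^ i)" for i :: nat
    using assms by (simp add: abs_mult min_def divide_simps)
qed

lemma lacunary_seq_pos: "0 < lacunary_seq k"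
  unfolding lacunary_seq_def
proof (rule suminf_pos2[OF summable_lacunary_seq, where i = k])
  have "k < 2 ^ k" by (rule less_exp)
  also have "(2::nat) ^ k \<le> 2 ^ 4 ^ k"
    by (intro power_increasing) (auto intro: less_imp_le power_gt_expt)
  finally show "0 < (if k < 2 ^ 4 ^ k then 4 ^ k / 2 ^ 4 ^ k else (0::real))" by simp
qed auto

lemma decseq_lacunary_seq: "decseq lacunary_seq"
  unfolding decseq_def lacunary_seq_def
  by (intro allI impI suminf_le summable_lacunary_seq) auto

text \<open>
  Of the first \<open>n + 1\<close> indices exactly \<open>min (n + 1) (2 ^ 4 ^ i)\<close> carry the \<open>i\<close>-th weight.
\<close>
lemma sum_lacunary_seq: "(\<Sum>k\<le>n. lacunary_seq k) = lacunary_sum (real n + 1)"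
proof -
  have "(\<Sum>k\<le>n. if k < 2 ^ 4 ^ i then 4 ^ i / 2 ^ 4 ^ i else 0)
      = 4 ^ i * min 1 ((real n + 1) / 2 ^ 4 ^ i)" for i
  proof -
    have "(\<Sum>k\<le>n. if k < 2 ^ 4 ^ i then 4 ^ i / 2 ^ 4 ^ i else (0::real))
        = (\<Sum>k\<in>{..n} \<inter> {k. k < 2 ^ 4 ^ i}. 4 ^ i / 2 ^ 4 ^ i)"
      by (subst sum.inter_restrict) auto
    also have "{..n} \<inter> {k. k < 2 ^ 4 ^ i} = {..<min (Suc n) (2 ^ 4 ^ i)}" by auto
    finally have "(\<Sum>k\<le>n. if k < 2 ^ 4 ^ i then 4 ^ i / 2 ^ 4 ^ i else (0::real))
        = real (min (Suc n) (2 ^ 4 ^ i)) * (4 ^ i / 2 ^ 4 ^ i)" by simp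
    moreover have "real (min (Suc n) (2 ^ 4 ^ i)) = min (real n + 1) (2 ^ 4 ^ i)"
      by (simp add: of_nat_min add.commute)
    moreover have "min 1 ((real n + 1) / 2 ^ 4 ^ i) = min (real n + 1) (2 ^ 4 ^ i) / 2 ^ 4 ^ i"
      by (simp add: min_def field_simps)
    ultimately show ?thesis by simp
  qed
  then show ?thesis
    unfolding lacunary_seq_def lacunary_sum_def
    by (subst suminf_sum[OF summable_lacunary_seq, where I = "{..n}" and k1 = "\<lambda>k. k", symmetric]) simp_all
qed

lemma lacunary_sum_mono: "0 \<le> x \<Longrightarrow> x \<le> y \<Longrightarrow> lacunary_sum x \<le> lacunary_sum y"
  unfolding lacunary_sum_def
  by (intro suminf_le summable_lacunary_sum mult_left_mono min.mono divide_right_mono) auto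

lemma sum_powers_of_4: "(\<Sum>j\<le>i. (4::real) ^ j) = (4 * 4 ^ i - 1) / 3"
  by (induction i) (simp_all add: field_simps)

lemma lacunary_sum_ge:
  assumes "2 ^ 4 ^ i \<le> x"
  shows "(4 * 4 ^ i - 1) / 3 \<le> lacunary_sum x"
proof -
  have "0 \<le> x" using assms by (smt (verit) zero_le_power)
  have "(\<Sum>j\<le>i. 4 ^ j) \<le> (\<Sum>j\<in>{..i}. 4 ^ j * min 1 (x / 2 ^ 4 ^ j))"
  proof (rule sum_mono)
    fix j assume "j \<in> {..i}"
    then have "(2::real) ^ 4 ^ j \<le> 2 ^ 4 ^ i" by (intro power_increasing) auto
    then have "2 ^ 4 ^ j \<le> x" using assms by (rule order_trans)
    then have "1 \<le> x / 2 ^ 4 ^ j" by (simp add: le_divide_eq)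
    then show "4 ^ j \<le> 4 ^ j * min 1 (x / 2 ^ 4 ^ j)" by simp
  qed
  also have "\<dots> \<le> lacunary_sum x"
    unfolding lacunary_sum_def
    by (rule sum_le_suminf[OF summable_lacunary_sum]) (use \<open>0 \<le> x\<close> in auto)
  finally show ?thesis by (simp add: sum_powers_of_4)
qed

text \<open>
  Below \<open>2 ^ 4 ^ (i + 1)\<close> the masses up to index \<open>i\<close> count in full, the next one in proportion to \<open>x\<close>, and
  the later ones are negligible, because \<open>2 ^ 4 ^ (j + 1)\<close> is the fourth power of \<open>2 ^ 4 ^ j\<close>.
\<close>
lemma lacunary_sum_le:
  assumes "0 \<le> x" "x \<le> 2 ^ 4 ^ Suc i"
  shows "lacunary_sum x \<le> (4 * 4 ^ i - 1) / 3 + 4 ^ Suc i * (x / 2 ^ 4 ^ Suc i) + 6"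
proof -
  define f where "f j = 4 ^ j * min 1 (x / 2 ^ 4 ^ j)" for j :: nat
  have f: "summable f" unfolding f_def by (rule summable_lacunary_sum) fact
  have f1: "f j \<le> 4 ^ j" and f2: "f j \<le> 4 ^ j * (x / 2 ^ 4 ^ j)" for j
    unfolding f_def by (simp, intro mult_left_mono) auto
  have tail: "f (j + Suc (Suc i)) \<le> 4 * (1 / 4) ^ j" for j
  proof -
    define m where "m = j + Suc i"
    define z where "z = (2::real) ^ 4 ^ m"
    have z: "1 \<le> z" by (simp add: z_def)
    have "(2::real) ^ 4 ^ Suc i \<le> z"
      unfolding z_def m_def by (intro power_increasing) auto
    with assms(2) have "x \<le> z" by (rule order_trans)
    also have "z \<le> z ^ 3" using power_increasing[of 1 3 z] z by simp
    finally have "x / z ^ 4 \<le> z ^ 3 / z ^ 4" using z by (intro divide_right_mono) auto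
    also have "\<dots> = 1 / z" using z by (simp add: power_eq_if)
    finally have x: "x / z ^ 4 \<le> 1 / z" .
    have "f (j + Suc (Suc i)) \<le> 4 ^ Suc m * (x / 2 ^ 4 ^ Suc m)"
      using f2[of "Suc m"] by (simp add: m_def)
    also have "(2::real) ^ 4 ^ Suc m = z ^ 4"
      by (simp only: z_def power_Suc2 power_mult)
    also have "4 ^ Suc m * (x / z ^ 4) \<le> 4 ^ Suc m * (1 / z)"
      by (intro mult_left_mono x) simp
    also have "\<dots> = 4 * (4 ^ m / 2 ^ 4 ^ m)" by (simp add: z_def)
    also have "\<dots> \<le> 4 * (1 / 4) ^ m" using lacunary_weight_le[of m] by simp
    also have "\<dots> \<le> 4 * (1 / 4) ^ j"
      using power_decreasing[of j m "1 / 4 :: real"] by (simp add: m_def)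
    finally show ?thesis .
  qed
  have geo: "summable (\<lambda>j. 4 * (1 / 4) ^ j :: real)" by (intro summable_mult summable_geometric) simp
  have "(\<Sum>j. f (j + Suc (Suc i))) \<le> (\<Sum>j. 4 * (1 / 4) ^ j)"
    using tail f geo by (intro suminf_le) (simp_all add: summable_iff_shift del: add_Suc_right)
  also have "\<dots> = 4 * (1 / (1 - 1 / 4))"
    by (subst suminf_mult[OF summable_geometric]) (simp_all add: suminf_geometric)
  also have "\<dots> \<le> 6" by simp
  finally have "(\<Sum>j. f (j + Suc (Suc i))) \<le> 6" .
  moreover have "(\<Sum>j<Suc (Suc i). f j) \<le> (\<Sum>j\<le>i. 4 ^ j) + 4 ^ Suc i * (x / 2 ^ 4 ^ Suc i)"
    using f2[of "Suc i"] sum_mono[of "{..i}" f "\<lambda>j. 4 ^ j"] f1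
    by (simp add: lessThan_Suc_atMost del: power_Suc)
  ultimately show ?thesis
    using suminf_split_initial_segment[OF f, of "Suc (Suc i)"]
    unfolding lacunary_sum_def f_def[symmetric] sum_powers_of_4 by linarith
qed

text \<open>
  In terms of \<open>u = log 2 x\<close> and the next jump \<open>y = 4 ^ (i + 1)\<close>, with \<open>q = y - u\<close>, the previous bound is
  \<open>y / 3 + y * 2 powr (- q)\<close> up to a constant.  As \<open>q \<le> 3 / 4 * y\<close>, the function
  \<open>y * (1 - 2 powr (- q))\<close> dominates \<open>4 / 3 * q\<close> up to a constant, which gives \<open>4 / 3 * (y - q)\<close>.
\<close>
lemma lacunary_sum_le_log:
  assumes "2 \<le> x"
  shows "lacunary_sum x \<le> 4 / 3 * log 2 x + 9"
proof -
  define u where "u = log 2 x"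
  have x: "x = 2 powr u" using assms by (simp add: u_def)
  have "1 \<le> u" using assms by (simp add: u_def)
  define i where "i = (LEAST i. u < 4 ^ Suc i)"
  have "\<exists>i. u < 4 ^ Suc i"
  proof -
    obtain n where "u < 4 ^ n" using real_arch_pow[of 4 u] by auto
    moreover have "(4::real) ^ n \<le> 4 ^ Suc n" by (rule power_increasing) auto
    ultimately show ?thesis using less_le_trans by blast
  qed
  then have i1: "u < 4 ^ Suc i" unfolding i_def by (rule LeastI_ex)
  have i2: "4 ^ i \<le> u"
  proof (cases i)
    case (Suc j)
    then have "j < (LEAST i. u < 4 ^ Suc i)" by (simp add: i_def)
    from not_less_Least[OF this] show ?thesis by (simp add: Suc)
  qed (use \<open>1 \<le> u\<close> in simp)
  define y :: real where "y = 4 ^ Suc i"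
  define q where "q = y - u"
  define p where "p = 2 powr (- q)"
  have q: "0 < q" "4 * q \<le> 3 * y" using i1 i2 by (auto simp: q_def y_def)
  have two_y: "(2::real) ^ 4 ^ Suc i = 2 powr y"
    by (simp add: y_def flip: powr_realpow)
  have "q / 2 \<le> exp (q * ln 2)"
    using exp_ge_add_one_self[of "q * ln 2"] ln2_ge_two_thirds q
      mult_left_mono[of "1 / 2" "ln 2" q] by linarith
  then have "q / 2 \<le> 2 powr q" by (simp add: powr_def mult.commute)
  then have "q * p \<le> 2" by (simp add: p_def powr_minus field_simps)
  have "p \<le> 1" using powr_mono[of "- q" 0 2] q by (simp add: p_def)
  then have "(y - 4 / 3 * q) * p \<le> y - 4 / 3 * q"
    using q by (intro mult_left_le) auto
  then have "y * p \<le> y - 4 / 3 * q + 8 / 3"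
    using \<open>q * p \<le> 2\<close> by (simp add: algebra_simps)
  moreover have "x / 2 ^ 4 ^ Suc i = p"
    by (simp only: two_y x p_def q_def powr_diff[symmetric]) simp
  moreover have "x \<le> 2 ^ 4 ^ Suc i"
    using i1 by (simp only: two_y x) (simp add: y_def)
  moreover have "(4 * 4 ^ i - 1) / 3 = (y - 1) / 3" "4 ^ Suc i = y" by (simp_all add: y_def)
  ultimately have "lacunary_sum x \<le> (y - 1) / 3 + y * p + 6"
    using lacunary_sum_le[of x i] assms by simp
  with \<open>y * p \<le> _\<close> show ?thesis
    unfolding q_def u_def by argo
qed

lemma lacunary_sum_le_ln: "lacunary_sum (real n + 1) \<le> 4 / (3 * ln 2) * ln (2 + real n) + 9"
  using lacunary_sum_mono[of "real n + 1" "2 + real n"] lacunary_sum_le_log[of "2 + real n"]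
  by (simp add: log_def)

text \<open>
  A decreasing sequence lies below its arithmetic means, here \<open>O (ln n / n)\<close>.
\<close>
lemma lacunary_seq_tendsto_0: "lacunary_seq \<longlonglongrightarrow> 0"
proof (rule tendsto_sandwich[OF _ _ tendsto_const])
  show "eventually (\<lambda>n. 0 \<le> lacunary_seq n) sequentially"
    using lacunary_seq_pos less_imp_le by (intro always_eventually) blast
  show "eventually (\<lambda>n. lacunary_seq n \<le> (4 / (3 * ln 2) * ln (2 + real n) + 9) / (real n + 1)) sequentially"
  proof (intro always_eventually allI)
    fix n
    have "(\<Sum>k\<le>n. lacunary_seq n) \<le> (\<Sum>k\<le>n. lacunary_seq k)"
      using decseq_lacunary_seq by (intro sum_mono) (auto simp: decseq_def)
    then have "lacunary_seq n * (real n + 1) \<le> lacunary_sum (real n + 1)"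
      by (simp add: sum_lacunary_seq algebra_simps)
    also note lacunary_sum_le_ln
    finally show "lacunary_seq n \<le> (4 / (3 * ln 2) * ln (2 + real n) + 9) / (real n + 1)"
      by (simp only: pos_le_divide_eq of_nat_0_le_iff add_nonneg_pos zero_less_one)
  qed
  show "(\<lambda>n. (4 / (3 * ln 2) * ln (2 + real n) + 9) / (real n + 1)) \<longlonglongrightarrow> 0"
    by real_asymp
qed

definition lacunary_mean :: "nat \<Rightarrow> real" where
  "lacunary_mean n = lacunary_sum (real n + 1) / ln (2 + real n)"

text \<open>
  Between the jumps at \<open>2 ^ 4 ^ i\<close> and \<open>2 ^ 4 ^ (i + 1)\<close>, away from both on the logarithmic scale.
\<close>
definition lacunary_gaps :: "nat set" where
  "lacunary_gaps = {n. \<exists>i. 2 ^ (2 * 4 ^ i) \<le> n \<and> n < 2 ^ (3 * 4 ^ i)}"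

lemma lacunary_mean_le: "lacunary_mean n \<le> 4 / (3 * ln 2) + 9 / ln (2 + real n)"
proof -
  have "0 < ln (2 + real n)" by simp
  then show ?thesis
    unfolding lacunary_mean_def using lacunary_sum_le_ln[of n]
    by (simp add: divide_le_eq distrib_right)
qed

text \<open>
  Here the partial sum is still about \<open>4 / 3 * 4 ^ i\<close>, whereas \<open>ln n\<close> has at least doubled since the jump
  at \<open>2 ^ 4 ^ i\<close>.
\<close>
lemma lacunary_mean_le_on_gaps:
  assumes "n \<in> lacunary_gaps"
  shows "lacunary_mean n \<le> 2 / (3 * ln 2) + 10 / ln (2 + real n)"
proof -
  obtain i where i: "2 ^ (2 * 4 ^ i) \<le> n" "n < 2 ^ (3 * 4 ^ i)"
    using assms unfolding lacunary_gaps_def by blast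
  define z where "z = (2::real) ^ 4 ^ i"
  have z: "1 \<le> z" "4 ^ i \<le> z"
    using square_le_two_power[of i] self_le_power[of "4 ^ i::real" 2] by (auto simp: z_def)
  have "Suc n \<le> 2 ^ (3 * 4 ^ i)" using i(2) by simp
  then have "real (Suc n) \<le> real (2 ^ (3 * 4 ^ i))" by (simp only: of_nat_le_iff)
  then have n: "real n + 1 \<le> z ^ 3"
    by (simp add: z_def mult.commute[of 3] power_mult add.commute)
  have z4: "(2::real) ^ 4 ^ Suc i = z ^ 4" by (simp only: z_def power_Suc2 power_mult)
  have "(real n + 1) / z ^ 4 \<le> z ^ 3 / z ^ 4" using z n by (intro divide_right_mono) auto
  also have "\<dots> = 1 / z" using z by (simp add: power_eq_if)
  finally have "4 ^ Suc i * ((real n + 1) / z ^ 4) \<le> 4 ^ Suc i * (1 / z)"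
    by (rule mult_left_mono) simp
  also have "\<dots> \<le> 4" using z by (simp add: divide_le_eq)
  finally have "lacunary_sum (real n + 1) \<le> (4 * 4 ^ i - 1) / 3 + 4 + 6"
    using lacunary_sum_le[of "real n + 1" i] n power_increasing[of 3 4 z] z unfolding z4 by simp
  then have *: "lacunary_sum (real n + 1) \<le> 4 / 3 * 4 ^ i + 10" by argo
  have "real (2 ^ (2 * 4 ^ i)) \<le> real n" using i(1) by (simp only: of_nat_le_iff)
  then have "(2::real) ^ (2 * 4 ^ i) \<le> 2 + real n"
    unfolding of_nat_power of_nat_numeral by linarith
  then have "ln (2 ^ (2 * 4 ^ i)) \<le> ln (2 + real n)" by (subst ln_le_cancel_iff) auto
  then have "2 * 4 ^ i * ln 2 \<le> ln (2 + real n)" by (simp add: ln_realpow)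
  then have "4 / 3 * 4 ^ i \<le> 2 / (3 * ln 2) * ln (2 + real n)" by (simp add: field_simps)
  with * have "lacunary_sum (real n + 1) \<le> 2 / (3 * ln 2) * ln (2 + real n) + 10" by simp
  moreover have "0 < ln (2 + real n)" by simp
  ultimately show ?thesis
    unfolding lacunary_mean_def by (simp add: divide_le_eq distrib_right)
qed

lemma lacunary_mean_nonneg: "0 \<le> lacunary_mean n"
  unfolding lacunary_mean_def sum_lacunary_seq[symmetric]
  by (intro divide_nonneg_nonneg sum_nonneg less_imp_le[OF lacunary_seq_pos]) auto

lemma lacunary_mean_bounded: "lacunary_mean \<in> l_inf"
proof -
  have "\<bar>lacunary_mean n\<bar> \<le> 4 / (3 * ln 2) + 9 / ln 2" for n
  proof -
    have "9 / ln (2 + real n) \<le> 9 / ln 2" by (intro divide_left_mono) auto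
    then show ?thesis using lacunary_mean_le[of n] lacunary_mean_nonneg[of n] by linarith
  qed
  then show ?thesis by (auto simp: l_inf_def bounded_iff)
qed

text \<open>
  Take \<open>A = (M + 1) * 2 ^ 4 ^ i\<close>.  All \<open>A div m\<close> lie beyond the jump, and their logarithms exceed
  \<open>4 ^ i * ln 2\<close> by at most a constant that depends on \<open>M\<close> only.
\<close>
lemma lacunary_mean_large_after_jump:
  assumes "\<epsilon> > 0"
  shows "\<exists>A\<ge>n. \<forall>m. 1 \<le> m \<longrightarrow> m \<le> M \<longrightarrow> lacunary_mean (A div m) \<ge> 4 / (3 * ln 2) - \<epsilon>"
proof -
  define c where "c = ln (3 * real (Suc M))"
  have "(\<lambda>i. ((4 * 4 ^ i - 1) / 3) / (c + 4 ^ i * ln 2)) \<longlonglongrightarrow> 4 / (3 * ln 2)"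
  proof -
    have "4 / (3 * ln 2) = 4 * inverse (ln 2 :: real) / 3" by (simp add: field_simps)
    then have "((\<lambda>y. ((4 * y - 1) / 3) / (c + y * ln 2)) \<longlongrightarrow> 4 / (3 * ln 2)) at_top"
      by (simp only:) real_asymp
    moreover have "filterlim (\<lambda>i. 4 ^ i :: real) at_top sequentially" by real_asymp
    ultimately show ?thesis by (rule filterlim_compose)
  qed
  then have "eventually (\<lambda>i. 4 / (3 * ln 2) - \<epsilon> < ((4 * 4 ^ i - 1) / 3) / (c + 4 ^ i * ln 2)) sequentially"
    by (rule order_tendstoD) (use assms in simp)
  then obtain n0 where n0: "\<And>i. i \<ge> n0 \<Longrightarrow>
      4 / (3 * ln 2) - \<epsilon> < ((4 * 4 ^ i - 1) / 3) / (c + 4 ^ i * ln 2)"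
    unfolding eventually_sequentially by blast
  define i where "i = max n n0"
  have i: "i \<ge> n" "4 / (3 * ln 2) - \<epsilon> < ((4 * 4 ^ i - 1) / 3) / (c + 4 ^ i * ln 2)"
    using n0[of i] by (auto simp: i_def)
  define N where "N = (2::nat) ^ 4 ^ i"
  have "lacunary_mean ((Suc M * N) div m) \<ge> 4 / (3 * ln 2) - \<epsilon>" if m: "1 \<le> m" "m \<le> M" for m
  proof -
    define k where "k = (Suc M * N) div m"
    have "N * m \<le> Suc M * N" using m by (subst mult.commute) (rule mult_le_mono1, simp)
    then have k1: "N \<le> k" unfolding k_def using m by (simp add: less_eq_div_iff_mult_less_eq)
    have k2: "k \<le> Suc M * N" unfolding k_def by (rule div_le_dividend)
    have "real N \<le> real k + 1" using k1 by simp
    then have sum: "(4 * 4 ^ i - 1) / 3 \<le> lacunary_sum (real k + 1)"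
      by (intro lacunary_sum_ge) (simp add: N_def)
    have "(1::real) \<le> 4 ^ Suc i" by (rule one_le_power) simp
    then have "0 \<le> (4 * 4 ^ i - 1) / (3::real)" by simp
    then have "0 \<le> lacunary_sum (real k + 1)" using sum by (rule order_trans)
    have "2 + k \<le> 3 * (Suc M * N)"
    proof -
      have "1 \<le> Suc M * N" by (simp add: N_def Suc_le_eq add_pos_nonneg)
      then show ?thesis using k2 by linarith
    qed
    then have "real (2 + k) \<le> real (3 * (Suc M * N))" by (simp only: of_nat_le_iff)
    then have "2 + real k \<le> 3 * real (Suc M) * 2 ^ 4 ^ i"
      by (simp only: of_nat_mult of_nat_add of_nat_numeral of_nat_power mult.assoc N_def)
    then have "ln (2 + real k) \<le> ln (3 * real (Suc M) * 2 ^ 4 ^ i)"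
      by (subst ln_le_cancel_iff) auto
    also have "\<dots> = ln (3 * real (Suc M)) + ln (2 ^ 4 ^ i)"
      by (rule ln_mult_pos) auto
    also have "\<dots> = c + 4 ^ i * ln 2" by (simp add: c_def ln_realpow)
    finally have "((4 * 4 ^ i - 1) / 3) / (c + 4 ^ i * ln 2) \<le> lacunary_mean k"
      unfolding lacunary_mean_def using sum \<open>0 \<le> lacunary_sum _\<close>
      by (intro frac_le) auto
    then show ?thesis using i(2) by (simp add: k_def)
  qed
  moreover have "n \<le> Suc M * N"
  proof -
    have "n \<le> 4 ^ i" using i(1) less_imp_le[OF power_gt_expt[of 4 i]] by linarith
    also have "\<dots> \<le> N" unfolding N_def by (rule less_imp_le[OF less_exp])
    finally show ?thesis by simp
  qed
  ultimately show ?thesis by blast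
qed

section \<open>Complex inner products and symmetric operators\<close>

instance complex_hilbert \<subseteq> banach ..

lemma additive_cinner_left: "Modules.additive (\<lambda>x. cinner x y)"
  by (simp add: Modules.additive_def cinner_add_left)

lemmas cinner_zero_left [simp] = Modules.additive.zero[OF additive_cinner_left]
  and cinner_diff_left = Modules.additive.diff[OF additive_cinner_left]
  and cinner_sum_left = Modules.additive.sum[OF additive_cinner_left]

lemma cnj_cinner [simp]: "cnj (cinner x y) = cinner y x"
  by (rule cinner_commute[symmetric])

lemma cinner_add_right: "cinner x (y + z) = cinner x y + cinner x z"
  by (metis cinner_add_left cinner_commute complex_cnj_add)

lemma cinner_scaleC_right: "cinner x (c *\<^sub>C y) = cnj c * cinner x y"
  by (metis cinner_commute cinner_scaleC_left complex_cnj_mult)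

lemma additive_cinner_right: "Modules.additive (cinner x)"
  by (simp add: Modules.additive_def cinner_add_right)

lemmas cinner_zero_right [simp] = Modules.additive.zero[OF additive_cinner_right]
  and cinner_diff_right = Modules.additive.diff[OF additive_cinner_right]
  and cinner_sum_right = Modules.additive.sum[OF additive_cinner_right]

lemma cinner_self: "cinner x x = complex_of_real ((norm x)\<^sup>2)"
proof (rule complex_eqI)
  have "cinner x x = cnj (cinner x x)" by (rule cinner_commute)
  then show "Im (cinner x x) = Im (complex_of_real ((norm x)\<^sup>2))"
    by (metis Im_complex_of_real Reals_cnj_iff complex_is_Real_iff)
qed (simp add: Re_cinner power2_norm_eq_inner)

lemma cinner_self_eq_0_iff: "cinner x x = 0 \<longleftrightarrow> x = 0"
  by (simp add: cinner_self)

lemma norm_scaleC: "norm (c *\<^sub>C x) = cmod c * norm x"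
proof (rule power2_eq_imp_eq)
  have "complex_of_real ((norm (c *\<^sub>C x))\<^sup>2) = (c * cnj c) * complex_of_real ((norm x)\<^sup>2)"
    by (simp only: cinner_self[symmetric] cinner_scaleC_left cinner_scaleC_right mult.left_commute mult.assoc)
  also have "\<dots> = complex_of_real ((cmod c * norm x)\<^sup>2)"
    by (simp only: complex_norm_square[symmetric] of_real_mult[symmetric] power_mult_distrib)
  finally show "(norm (c *\<^sub>C x))\<^sup>2 = (cmod c * norm x)\<^sup>2"
    by (simp only: of_real_eq_iff)
qed simp_all

lemma norm_cinner_commute: "cmod (cinner x y) = cmod (cinner y x)"
  by (metis cnj_cinner complex_mod_cnj)

text \<open>
  A rotation by the phase of the inner product reduces this to the real Cauchy--Schwarz inequality.
\<close>
lemma norm_cinner_le: "cmod (cinner x y) \<le> norm x * norm y"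
proof (cases "cinner x y = 0")
  case False
  define c where "c = cinner y x / cmod (cinner x y)"
  have "cmod c = 1" using False by (simp add: c_def norm_divide norm_cinner_commute[of y x])
  have "c * cinner x y = complex_of_real (cmod (cinner x y))"
    using False complex_norm_square[of "cinner x y"]
    by (simp add: c_def divide_eq_eq power2_eq_square mult.commute)
  then have "cmod (cinner x y) = Re (cinner (c *\<^sub>C x) y)"
    by (simp add: cinner_scaleC_left del: cnj_cinner)
  also have "\<dots> \<le> norm (c *\<^sub>C x) * norm y"
    unfolding Re_cinner by (rule norm_cauchy_schwarz)
  finally show ?thesis using \<open>cmod c = 1\<close> by (simp add: norm_scaleC)
qed simp

lemma cinner_scaleR_left: "cinner (r *\<^sub>R x) y = r *\<^sub>R cinner x y"
  by (simp add: scaleC_of_real[symmetric] cinner_scaleC_left scaleR_conv_of_real)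

lemma bounded_linear_cinner_left: "bounded_linear (\<lambda>x. cinner x y)"
  by (rule bounded_linear_intro[where K = "norm y"])
     (auto simp: cinner_add_left cinner_scaleR_left norm_cinner_le)

lemma bounded_linear_scaleC_right: "bounded_linear (\<lambda>x::'a::complex_hilbert. c *\<^sub>C x)"
  by (rule bounded_linear_intro[where K = "cmod c"])
     (simp_all add: scaleC_add_right norm_scaleC scaleC_scaleC scaleC_of_real[symmetric] mult.commute)

lemma bounded_linear_scaleC_left: "bounded_linear (\<lambda>c. c *\<^sub>C (x::'a::complex_hilbert))"
  by (rule bounded_linear_intro[where K = "norm x"])
     (simp_all add: scaleC_add_left norm_scaleC scaleC_scaleC scaleC_of_real[symmetric] scaleR_conv_of_real)

lemma cinner_ext:
  assumes "\<And>x. cinner x y = cinner x z"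
  shows "y = z"
  using assms[of "y - z"] cinner_self_eq_0_iff[of "y - z"]
  by (simp add: cinner_diff_right)

lemma adjoint_op_self:
  assumes "bounded_op T" and "\<And>x y. cinner (T x) y = cinner x (T y)"
  shows "adjoint_op T = T"
  unfolding adjoint_op_def
proof (rule the_equality)
  show "bounded_op T \<and> (\<forall>x y. cinner (T x) y = cinner x (T y))" using assms by blast
next
  fix S assume "bounded_op S \<and> (\<forall>x y. cinner (T x) y = cinner x (S y))"
  then show "S = T" using assms(2) by (metis cinner_ext ext)
qed

text \<open>
  Polarization: the quadratic form is real at \<open>x + y\<close> and at \<open>x + \<i> *\<^sub>C y\<close>.
\<close>
lemma positive_op_symmetric:
  assumes "positive_op S"
  shows "cinner (S x) y = cinner x (S y)"
proof -
  have S_add: "S (u + v) = S u + S v" and S_scale: "S (c *\<^sub>C u) = c *\<^sub>C S u" for u v c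
    using assms by (simp_all add: positive_op_def bounded_op_def linear_simps)
  have im: "Im (cinner (S u) u) = 0" for u
    using assms by (simp add: positive_op_def complex_nonneg_Reals_iff)
  have "Im (cinner (S (x + y)) (x + y)) = 0" "Im (cinner (S (x + \<i> *\<^sub>C y)) (x + \<i> *\<^sub>C y)) = 0"
    by (rule im)+
  then have "Im (cinner (S x) y + cinner (S y) x) = 0" "Re (cinner (S y) x - cinner (S x) y) = 0"
    by (simp_all add: S_add S_scale cinner_add_left cinner_add_right cinner_scaleC_left
        cinner_scaleC_right im)
  then have "Im (cinner (S x) y) = - Im (cinner (S y) x)" "Re (cinner (S x) y) = Re (cinner (S y) x)"
    by simp_all
  then have "cinner (S x) y = cnj (cinner (S y) x)" by (simp add: complex_eq_iff del: cnj_cinner)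
  then show ?thesis by simp
qed

section \<open>Orthonormal sequences and diagonal operators\<close>

definition orthonormal_seq :: "(nat \<Rightarrow> 'a::complex_hilbert) \<Rightarrow> bool" where
  "orthonormal_seq e \<longleftrightarrow> (\<forall>i j. cinner (e i) (e j) = (if i = j then 1 else 0))"

text \<open>
  Gram--Schmidt: the span of finitely many vectors is never everything.
\<close>
lemma exists_orthonormal_seq:
  assumes "\<And>B :: 'a::complex_hilbert set. finite B \<Longrightarrow> complex_vector.span B \<noteq> UNIV"
  shows "\<exists>e :: nat \<Rightarrow> 'a. orthonormal_seq e"
proof -
  define P :: "(nat \<Rightarrow> 'a) \<Rightarrow> nat \<Rightarrow> 'a \<Rightarrow> bool" where
    "P e n v \<longleftrightarrow> cinner v v = 1 \<and> (\<forall>m<n. cinner v (e m) = 0)" for e n v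
  have "\<exists>e. \<forall>n. P e n (e n)"
  proof (rule dependent_wellorder_choice)
    show "P f n r = P g n r" if "\<And>m. m < n \<Longrightarrow> f m = g m" for r f g n
      using that by (simp add: P_def)
  next
    fix n and e :: "nat \<Rightarrow> 'a" assume P: "\<And>m. m < n \<Longrightarrow> P e m (e m)"
    have unit: "cinner (e m) (e m) = 1" if "m < n" for m
      using P[OF that] by (simp add: P_def)
    have lower: "cinner (e i) (e j) = 0" if "i < n" "j < i" for i j
      using P[OF that(1)] that(2) by (simp add: P_def)
    have orth: "cinner (e i) (e j) = 0" if "i < n" "j < n" "i \<noteq> j" for i j
      using that lower[of i j] lower[of j i] cnj_cinner[of "e j" "e i"]
      by (cases "j < i") (simp_all del: cnj_cinner)
    obtain x where x: "x \<notin> complex_vector.span (e ` {..<n})"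
      using assms[of "e ` {..<n}"] by blast
    define y where "y = x - (\<Sum>j<n. cinner x (e j) *\<^sub>C e j)"
    have "(\<Sum>j<n. cinner x (e j) *\<^sub>C e j) \<in> complex_vector.span (e ` {..<n})"
      by (intro complex_vector.span_sum complex_vector.span_scale complex_vector.span_base) auto
    with x have "y \<noteq> 0" by (auto simp: y_def)
    have "cinner y (e m) = 0" if "m < n" for m
    proof -
      have "(\<Sum>j<n. cinner x (e j) * cinner (e j) (e m)) = (\<Sum>j<n. if j = m then cinner x (e m) else 0)"
        using that by (intro sum.cong) (auto simp: unit orth)
      then show ?thesis
        using that by (simp add: y_def cinner_diff_left cinner_sum_left cinner_scaleC_left)
    qed
    moreover have "cinner (complex_of_real (1 / norm y) *\<^sub>C y) (complex_of_real (1 / norm y) *\<^sub>C y) = 1"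
      using \<open>y \<noteq> 0\<close> by (simp add: cinner_self norm_scaleC norm_divide)
    ultimately have "P e n (complex_of_real (1 / norm y) *\<^sub>C y)"
      by (simp add: P_def cinner_scaleC_left)
    then show "\<exists>v. P e n v" by blast
  qed
  then obtain e where e: "\<And>n. P e n (e n)" by blast
  have lower: "cinner (e i) (e j) = 0" if "j < i" for i j
    using e[of i] that by (simp add: P_def)
  have "cinner (e i) (e j) = (if i = j then 1 else 0)" for i j
    using e[of i] lower[of i j] lower[of j i] cnj_cinner[of "e j" "e i"]
    by (cases i j rule: linorder_cases) (simp_all add: P_def del: cnj_cinner)
  then show ?thesis unfolding orthonormal_seq_def by blast
qed

lemma norm_orthonormal_sum:
  assumes e: "orthonormal_seq e" and "finite A"
  shows "(norm (\<Sum>n\<in>A. c n *\<^sub>C e n))\<^sup>2 = (\<Sum>n\<in>A. (cmod (c n))\<^sup>2)"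
proof -
  have "cinner (\<Sum>n\<in>A. c n *\<^sub>C e n) (\<Sum>n\<in>A. c n *\<^sub>C e n)
      = (\<Sum>n\<in>A. \<Sum>m\<in>A. if m = n then cnj (c n) * c n else 0)"
    unfolding cinner_sum_left cinner_sum_right cinner_scaleC_left cinner_scaleC_right sum_distrib_left
    using e by (intro sum.cong) (auto simp: orthonormal_seq_def)
  also have "\<dots> = complex_of_real (\<Sum>n\<in>A. (cmod (c n))\<^sup>2)"
    using \<open>finite A\<close> by (simp only: of_real_sum complex_norm_square mult.commute sum.delta) simp
  finally show ?thesis by (simp only: cinner_self of_real_eq_iff)
qed

lemma bessel_inequality:
  assumes e: "orthonormal_seq e" and "finite A"
  shows "(\<Sum>n\<in>A. (cmod (cinner x (e n)))\<^sup>2) \<le> (norm x)\<^sup>2"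
proof -
  define p where "p = (\<Sum>n\<in>A. cinner x (e n) *\<^sub>C e n)"
  define b where "b = (\<Sum>n\<in>A. (cmod (cinner x (e n)))\<^sup>2)"
  have p: "(norm p)\<^sup>2 = b" unfolding p_def b_def by (rule norm_orthonormal_sum) fact+
  have "cinner x p = (\<Sum>n\<in>A. complex_of_real ((cmod (cinner x (e n)))\<^sup>2))"
    unfolding p_def cinner_sum_right cinner_scaleC_right complex_norm_square
    by (simp add: mult.commute)
  then have "inner x p = b"
    unfolding Re_cinner[symmetric] b_def by simp
  moreover have "0 \<le> (norm (x - p))\<^sup>2" by simp
  moreover have "(norm (x - p))\<^sup>2 = (norm x)\<^sup>2 - 2 * inner x p + (norm p)\<^sup>2"
    unfolding power2_norm_eq_inner by (simp add: inner_diff_left inner_diff_right inner_commute)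
  ultimately show ?thesis using p by (simp add: b_def)
qed

definition diagonal_op :: "(nat \<Rightarrow> 'a::complex_hilbert) \<Rightarrow> (nat \<Rightarrow> real) \<Rightarrow> 'a \<Rightarrow> 'a" where
  "diagonal_op e d x = (\<Sum>n. (complex_of_real (d n) * cinner x (e n)) *\<^sub>C e n)"

lemma norm_diagonal_partial_sum:
  assumes e: "orthonormal_seq e" and d: "\<And>n. \<bar>d n\<bar> \<le> D" and "finite A"
  shows "(norm (\<Sum>n\<in>A. (complex_of_real (d n) * cinner x (e n)) *\<^sub>C e n))\<^sup>2
           \<le> D\<^sup>2 * (\<Sum>n\<in>A. (cmod (cinner x (e n)))\<^sup>2)"
proof -
  have "(d n)\<^sup>2 \<le> D\<^sup>2" for n
    using d[of n] by (simp add: abs_le_square_iff[symmetric])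
  then show ?thesis
    unfolding norm_orthonormal_sum[OF e \<open>finite A\<close>] sum_distrib_left
    by (intro sum_mono) (auto simp: norm_mult power_mult_distrib intro!: mult_right_mono)
qed

text \<open>
  By Pythagoras and Bessel's inequality the partial sums form a Cauchy sequence.
\<close>
lemma summable_diagonal:
  assumes e: "orthonormal_seq e" and d: "d \<in> l_inf"
  shows "summable (\<lambda>n. (complex_of_real (d n) * cinner x (e n)) *\<^sub>C e n)"
  unfolding summable_Cauchy
proof (intro allI impI)
  fix \<epsilon> :: real assume "\<epsilon> > 0"
  obtain D where D: "\<And>n. \<bar>d n\<bar> \<le> D" using d by (rule l_infE) blast
  have "0 \<le> D" using D[of 0] by linarith
  have "summable (\<lambda>n. (cmod (cinner x (e n)))\<^sup>2)"
    by (rule summableI_nonneg_bounded) (use bessel_inequality[OF e] in auto)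
  moreover have "0 < (\<epsilon> / (D + 1))\<^sup>2" using \<open>0 \<le> D\<close> \<open>\<epsilon> > 0\<close> by simp
  ultimately obtain N where N: "\<And>m n. m \<ge> N \<Longrightarrow>
      norm (\<Sum>k\<in>{m..<n}. (cmod (cinner x (e k)))\<^sup>2) < (\<epsilon> / (D + 1))\<^sup>2"
    unfolding summable_Cauchy by blast
  show "\<exists>N. \<forall>m\<ge>N. \<forall>n. norm (\<Sum>k\<in>{m..<n}. (complex_of_real (d k) * cinner x (e k)) *\<^sub>C e k) < \<epsilon>"
  proof (intro exI allI impI)
    fix m n assume "m \<ge> N"
    let ?b = "\<Sum>k\<in>{m..<n}. (cmod (cinner x (e k)))\<^sup>2"
    have b: "0 \<le> ?b" "?b < (\<epsilon> / (D + 1))\<^sup>2"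
      using N[OF \<open>m \<ge> N\<close>, of n] by (auto intro: sum_nonneg)
    have "(norm (\<Sum>k\<in>{m..<n}. (complex_of_real (d k) * cinner x (e k)) *\<^sub>C e k))\<^sup>2 \<le> D\<^sup>2 * ?b"
      by (rule norm_diagonal_partial_sum[OF e D]) simp
    also have "\<dots> \<le> (D + 1)\<^sup>2 * ?b"
      using b \<open>0 \<le> D\<close> by (intro mult_right_mono power_mono) auto
    also have "\<dots> < (D + 1)\<^sup>2 * (\<epsilon> / (D + 1))\<^sup>2"
      using b \<open>0 \<le> D\<close> by (intro mult_strict_left_mono) auto
    also have "\<dots> = \<epsilon>\<^sup>2" using \<open>0 \<le> D\<close> by (simp add: power_divide)
    finally show "norm (\<Sum>k\<in>{m..<n}. (complex_of_real (d k) * cinner x (e k)) *\<^sub>C e k) < \<epsilon>"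
      by (rule power2_less_imp_less) (use \<open>\<epsilon> > 0\<close> in simp)
  qed
qed

lemma norm_diagonal_op_le:
  assumes e: "orthonormal_seq e" and d: "\<And>n. \<bar>d n\<bar> \<le> D"
  shows "norm (diagonal_op e d x) \<le> D * norm x"
proof (rule LIMSEQ_le_const2)
  show "(\<lambda>N. norm (\<Sum>n<N. (complex_of_real (d n) * cinner x (e n)) *\<^sub>C e n))
      \<longlonglongrightarrow> norm (diagonal_op e d x)"
    unfolding diagonal_op_def
    by (intro tendsto_norm summable_LIMSEQ summable_diagonal[OF e] l_infI[of d D] d)
  have "0 \<le> D" using d[of 0] by linarith
  show "\<exists>N0. \<forall>N\<ge>N0. norm (\<Sum>n<N. (complex_of_real (d n) * cinner x (e n)) *\<^sub>C e n) \<le> D * norm x"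
  proof (intro exI allI impI)
    fix N :: nat
    have "(norm (\<Sum>n<N. (complex_of_real (d n) * cinner x (e n)) *\<^sub>C e n))\<^sup>2
        \<le> D\<^sup>2 * (\<Sum>n<N. (cmod (cinner x (e n)))\<^sup>2)"
      by (rule norm_diagonal_partial_sum[OF e d]) simp
    also have "\<dots> \<le> D\<^sup>2 * (norm x)\<^sup>2"
      by (intro mult_left_mono bessel_inequality[OF e]) auto
    also have "\<dots> = (D * norm x)\<^sup>2" by (simp only: power_mult_distrib)
    finally show "norm (\<Sum>n<N. (complex_of_real (d n) * cinner x (e n)) *\<^sub>C e n) \<le> D * norm x"
      by (rule power2_le_imp_le) (use \<open>0 \<le> D\<close> in simp)
  qed
qed

lemma bounded_op_diagonal:
  assumes e: "orthonormal_seq e" and d: "d \<in> l_inf"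
  shows "bounded_op (diagonal_op e d)"
proof -
  obtain D where D: "\<And>n. \<bar>d n\<bar> \<le> D" using d by (rule l_infE) blast
  note summable = summable_diagonal[OF e d]
  have scale: "diagonal_op e d (c *\<^sub>C x) = c *\<^sub>C diagonal_op e d x" for c x
    unfolding diagonal_op_def bounded_linear.suminf[OF bounded_linear_scaleC_right summable]
    by (simp add: cinner_scaleC_left scaleC_scaleC mult.left_commute mult.assoc)
  have "bounded_linear (diagonal_op e d)"
  proof (rule bounded_linear_intro[where K = D])
    show "diagonal_op e d (x + y) = diagonal_op e d x + diagonal_op e d y" for x y
      unfolding diagonal_op_def suminf_add[OF summable summable]
      by (simp add: cinner_add_left distrib_left scaleC_add_left)
    show "diagonal_op e d (r *\<^sub>R x) = r *\<^sub>R diagonal_op e d x" for r x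
      by (simp add: scale flip: scaleC_of_real)
    show "norm (diagonal_op e d x) \<le> norm x * D" for x
      using norm_diagonal_op_le[of e d D x, OF e D] by (simp add: mult.commute)
  qed
  with scale show ?thesis by (simp add: bounded_op_def)
qed

lemma cinner_diagonal_op_sums:
  assumes e: "orthonormal_seq e" and d: "d \<in> l_inf"
  shows "(\<lambda>n. complex_of_real (d n) * cinner x (e n) * cinner (e n) y) sums cinner (diagonal_op e d x) y"
proof -
  have "(\<lambda>n. (complex_of_real (d n) * cinner x (e n)) *\<^sub>C e n) sums diagonal_op e d x"
    unfolding diagonal_op_def by (intro summable_sums summable_diagonal[OF e d])
  from bounded_linear.sums[OF bounded_linear_cinner_left[of y] this]
  show ?thesis by (simp add: cinner_scaleC_left)
qed

lemma cinner_diagonal_op: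
  assumes e: "orthonormal_seq e" and d: "d \<in> l_inf"
  shows "cinner (diagonal_op e d x) (e m) = complex_of_real (d m) * cinner x (e m)"
proof -
  have "(\<lambda>n. complex_of_real (d n) * cinner x (e n) * cinner (e n) (e m))
      = (\<lambda>n. if n = m then complex_of_real (d m) * cinner x (e m) else 0)"
    using e by (auto simp: orthonormal_seq_def)
  then have "(\<lambda>n. if n = m then complex_of_real (d m) * cinner x (e m) else 0)
      sums cinner (diagonal_op e d x) (e m)"
    using cinner_diagonal_op_sums[OF e d, of x "e m"] by simp
  then show ?thesis
    using sums_single[of m "\<lambda>_. complex_of_real (d m) * cinner x (e m)"] by (rule sums_unique2)
qed

lemma diagonal_op_eq_0:
  "(\<And>n. cinner x (e n) = 0) \<Longrightarrow> diagonal_op e d x = 0"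
  by (simp add: diagonal_op_def)

lemma diagonal_op_basis:
  assumes e: "orthonormal_seq e"
  shows "diagonal_op e d (e m) = complex_of_real (d m) *\<^sub>C e m"
proof -
  have "(\<lambda>n. (complex_of_real (d n) * cinner (e m) (e n)) *\<^sub>C e n)
      = (\<lambda>n. if n = m then complex_of_real (d m) *\<^sub>C e m else 0)"
    using e by (auto simp: orthonormal_seq_def)
  then show ?thesis
    unfolding diagonal_op_def
    using sums_unique[OF sums_single[of m "\<lambda>_. complex_of_real (d m) *\<^sub>C e m"]] by simp
qed

lemma diagonal_op_symmetric:
  assumes e: "orthonormal_seq e" and d: "d \<in> l_inf"
  shows "cinner (diagonal_op e d x) y = cinner x (diagonal_op e d y)"
proof -
  have "(\<lambda>n. cnj (complex_of_real (d n) * cinner y (e n) * cinner (e n) x)) sums cnj (cinner (diagonal_op e d y) x)"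
    using cinner_diagonal_op_sums[OF e d] by (simp only: sums_cnj)
  moreover have "(\<lambda>n. cnj (complex_of_real (d n) * cinner y (e n) * cinner (e n) x))
      = (\<lambda>n. complex_of_real (d n) * cinner x (e n) * cinner (e n) y)"
    by (simp add: mult_ac)
  ultimately show ?thesis
    using cinner_diagonal_op_sums[OF e d, of x y] by (simp add: sums_iff)
qed

lemma positive_op_diagonal:
  assumes e: "orthonormal_seq e" and d: "d \<in> l_inf" and "\<And>n. 0 \<le> d n"
  shows "positive_op (diagonal_op e d)"
  unfolding positive_op_def
proof (intro conjI allI bounded_op_diagonal[OF e d])
  fix x
  have "complex_of_real (d n) * cinner x (e n) * cinner (e n) x
      = complex_of_real (d n * (cmod (cinner x (e n)))\<^sup>2)" for n
    by (simp only: of_real_mult complex_norm_square cnj_cinner mult.assoc)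
  then have sums: "(\<lambda>n. complex_of_real (d n * (cmod (cinner x (e n)))\<^sup>2)) sums cinner (diagonal_op e d x) x"
    using cinner_diagonal_op_sums[OF e d, of x x] by (simp only:)
  have "(\<lambda>n. d n * (cmod (cinner x (e n)))\<^sup>2) sums Re (cinner (diagonal_op e d x) x)"
    using sums_Re[OF sums] by simp
  then have "0 \<le> Re (cinner (diagonal_op e d x) x)"
    by (rule sums_le[OF _ sums_zero, rotated]) (use assms(3) in simp)
  moreover have "(\<lambda>n. 0) sums Im (cinner (diagonal_op e d x) x)"
    using sums_Im[OF sums] by simp
  ultimately show "cinner (diagonal_op e d x) x \<in> \<real>\<^sub>\<ge>\<^sub>0"
    by (simp add: complex_nonneg_Reals_iff sums_iff)
qed

section \<open>Singular values of diagonal operators\<close>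

text \<open>
  For \<open>c = d n\<close>, the vector \<open>e n\<close> is annihilated by \<open>S\<^sup>2 - c\<^sup>2 = (S + c) (S - c)\<close>, and \<open>S + c\<close> is injective
  because \<open>S \<ge> 0\<close> and \<open>c > 0\<close>; so \<open>S\<close> and the diagonal operator \<open>T\<close> agree at \<open>e n\<close>.  For arbitrary \<open>x\<close>, the
  vector \<open>y = S x - T x\<close> is then orthogonal to all \<open>e n\<close>, which forces \<open>T y = 0\<close> and \<open>S y = 0\<close>, whence \<open>cinner y y = 0\<close> by symmetry.
\<close>
lemma positive_sqrt_diagonal_unique:
  assumes e: "orthonormal_seq e" and d: "d \<in> l_inf" and pos: "\<And>n. 0 < d n"
    and S: "positive_op S" and sq: "\<And>x. S (S x) = diagonal_op e d (diagonal_op e d x)"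
  shows "S = diagonal_op e d"
proof
  fix x
  let ?T = "diagonal_op e d"
  note sym = positive_op_symmetric[OF S]
  have S_diff: "S (u - v) = S u - S v" and S_scale: "S (c *\<^sub>C u) = c *\<^sub>C S u" for u v c
    using S by (simp_all add: positive_op_def bounded_op_def linear_simps)
  have T_scale: "?T (c *\<^sub>C u) = c *\<^sub>C ?T u" for u c
    using bounded_op_diagonal[OF e d] by (simp add: bounded_op_def)
  have S_basis: "S (e n) = complex_of_real (d n) *\<^sub>C e n" for n
  proof -
    define y where "y = S (e n) - complex_of_real (d n) *\<^sub>C e n"
    have "S y = - (complex_of_real (d n) *\<^sub>C y)"
      by (simp add: y_def S_diff S_scale sq diagonal_op_basis[OF e] T_scale
          complex_vector.scale_right_diff_distrib)
    then have "S y = complex_of_real (- d n) *\<^sub>C y" by simp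
    then have "cinner (S y) y = complex_of_real (- (d n * (norm y)\<^sup>2))"
      by (simp only: cinner_scaleC_left cinner_self) simp
    moreover have "cinner (S y) y \<in> \<real>\<^sub>\<ge>\<^sub>0" using S by (simp add: positive_op_def)
    ultimately have "d n * (norm y)\<^sup>2 \<le> 0"
      by (simp only: nonneg_Reals_of_real_iff)
    then have "y = 0" using pos[of n] by (simp add: mult_le_0_iff)
    then show ?thesis by (simp add: y_def)
  qed
  define y where "y = S x - ?T x"
  have y_e: "cinner y (e n) = 0" for n
    by (simp add: y_def cinner_diff_left sym S_basis cinner_scaleC_right cinner_diagonal_op[OF e d])
  then have Ty: "?T y = 0" by (rule diagonal_op_eq_0)
  then have "S (S y) = 0" using sq[of y] T_scale[of 0 0] by simp
  then have "cinner (S y) (S y) = 0" using sym[of y "S y"] by simp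
  then have Sy: "S y = 0" by (simp add: cinner_self_eq_0_iff)
  have "cinner y y = cinner (S y) x - cinner (?T y) x"
    by (simp add: sym diagonal_op_symmetric[OF e d] cinner_diff_right[symmetric] y_def[symmetric])
  then have "y = 0" using Sy Ty by (simp add: cinner_self_eq_0_iff)
  then show "S x = ?T x" by (simp add: y_def)
qed

lemma abs_op_diagonal:
  assumes e: "orthonormal_seq e" and d: "d \<in> l_inf" and pos: "\<And>n. 0 < d n"
  shows "abs_op (diagonal_op e d) = diagonal_op e d"
proof -
  have "adjoint_op (diagonal_op e d) = diagonal_op e d"
    by (intro adjoint_op_self bounded_op_diagonal[OF e d] diagonal_op_symmetric[OF e d])
  moreover have "(THE S. positive_op S \<and> S \<circ> S = diagonal_op e d \<circ> diagonal_op e d) = diagonal_op e d"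
  proof (rule the_equality)
    show "positive_op (diagonal_op e d) \<and>
        diagonal_op e d \<circ> diagonal_op e d = diagonal_op e d \<circ> diagonal_op e d"
      using positive_op_diagonal[OF e d less_imp_le[OF pos]] by blast
  next
    fix S assume S: "positive_op S \<and> S \<circ> S = diagonal_op e d \<circ> diagonal_op e d"
    then have "S (S x) = diagonal_op e d (diagonal_op e d x)" for x by (metis comp_apply)
    with S show "S = diagonal_op e d" by (intro positive_sqrt_diagonal_unique[OF e d pos]) auto
  qed
  ultimately show ?thesis by (simp only: abs_op_def)
qed

text \<open>
  The vectors \<open>e j\<close> with \<open>d j = r\<close> span the eigenspace: what remains of an eigenvector after projection
  is orthogonal to all \<open>e j\<close>, hence lies in the kernel, and \<open>r \<noteq> 0\<close>.
\<close>
lemma dim_eigenspace_diagonal: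
  assumes e: "orthonormal_seq e" and d: "d \<in> l_inf" and "r \<noteq> 0" and fin: "finite {j. d j = r}"
  shows "complex_vector.dim (eigenspace (diagonal_op e d) (complex_of_real r)) = card {j. d j = r}"
proof -
  define J where "J = {j. d j = r}"
  have inj: "inj_on e J"
    using e unfolding orthonormal_seq_def by (intro inj_onI) (metis zero_neq_one)
  have "finite J" using fin by (simp add: J_def)
  have T_diff: "diagonal_op e d (u - v) = diagonal_op e d u - diagonal_op e d v"
    and T_sum: "diagonal_op e d (\<Sum>j\<in>J. f j) = (\<Sum>j\<in>J. diagonal_op e d (f j))"
    and T_scale: "diagonal_op e d (c *\<^sub>C u) = c *\<^sub>C diagonal_op e d u" for u v c f
    using bounded_op_diagonal[OF e d]
    by (simp_all add: bounded_op_def linear_simps linear_sum bounded_linear.linear)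
  have coeff: "cinner (\<Sum>j\<in>J. c j *\<^sub>C e j) (e m) = (if m \<in> J then c m else 0)" for c m
  proof -
    have "cinner (\<Sum>j\<in>J. c j *\<^sub>C e j) (e m) = (\<Sum>j\<in>J. if j = m then c m else 0)"
      unfolding cinner_sum_left cinner_scaleC_left
      using e by (intro sum.cong) (auto simp: orthonormal_seq_def)
    then show ?thesis using \<open>finite J\<close> by simp
  qed
  have "complex_vector.independent (e ` J)"
  proof (rule complex_vector.independent_if_scalars_zero)
    fix f x assume *: "(\<Sum>x\<in>e ` J. f x *\<^sub>C x) = 0" "x \<in> e ` J"
    then obtain j where j: "j \<in> J" "x = e j" by blast
    have "(\<Sum>j\<in>J. f (e j) *\<^sub>C e j) = 0"
      using *(1) by (simp add: sum.reindex[OF inj])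
    then show "f x = 0" using coeff[of "\<lambda>j. f (e j)" j] j by simp
  qed (use \<open>finite J\<close> in simp)
  moreover have "eigenspace (diagonal_op e d) (complex_of_real r) = complex_vector.span (e ` J)"
  proof (intro equalityI subsetI)
    fix x assume "x \<in> eigenspace (diagonal_op e d) (complex_of_real r)"
    then have Tx: "diagonal_op e d x = complex_of_real r *\<^sub>C x" by (simp add: eigenspace_def)
    define y where "y = x - (\<Sum>j\<in>J. cinner x (e j) *\<^sub>C e j)"
    have "diagonal_op e d (\<Sum>j\<in>J. cinner x (e j) *\<^sub>C e j)
        = complex_of_real r *\<^sub>C (\<Sum>j\<in>J. cinner x (e j) *\<^sub>C e j)"
      unfolding T_sum complex_vector.scale_sum_right
      by (intro sum.cong) (auto simp: T_scale diagonal_op_basis[OF e] J_def scaleC_scaleC mult.commute)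
    then have Ty: "diagonal_op e d y = complex_of_real r *\<^sub>C y"
      by (simp add: y_def T_diff Tx complex_vector.scale_right_diff_distrib)
    have "cinner y (e m) = 0" for m
    proof (cases "m \<in> J")
      case True
      then show ?thesis by (simp add: y_def cinner_diff_left coeff)
    next
      case False
      have "complex_of_real r * cinner y (e m) = complex_of_real (d m) * cinner y (e m)"
        using cinner_diagonal_op[OF e d, of y m] by (simp add: Ty cinner_scaleC_left)
      then show ?thesis using False by (auto simp: J_def)
    qed
    then have "diagonal_op e d y = 0" by (rule diagonal_op_eq_0)
    then have "y = 0" using Ty \<open>r \<noteq> 0\<close> by simp
    then have "x = (\<Sum>j\<in>J. cinner x (e j) *\<^sub>C e j)" by (simp add: y_def)
    then show "x \<in> complex_vector.span (e ` J)"
      by (metis (no_types, lifting) complex_vector.span_base complex_vector.span_scale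
          complex_vector.span_sum imageI)
  next
    fix x assume "x \<in> complex_vector.span (e ` J)"
    then show "x \<in> eigenspace (diagonal_op e d) (complex_of_real r)"
    proof (induction rule: complex_vector.span_induct_alt)
      case base
      show ?case using T_scale[of 0 0] by (simp add: eigenspace_def)
    next
      case (step c x y)
      have "diagonal_op e d (c *\<^sub>C x + y) = c *\<^sub>C diagonal_op e d x + diagonal_op e d y"
        using bounded_op_diagonal[OF e d] by (simp add: bounded_op_def linear_simps)
      with step show ?case
        by (auto simp: eigenspace_def diagonal_op_basis[OF e] J_def scaleC_add_right scaleC_scaleC mult.commute)
    qed
  qed
  ultimately show ?thesis
    using card_image[OF inj] by (simp add: complex_vector.dim_eq_card_independent J_def)
qed

text \<open>
  At the first index where two such sequences differ, the larger value \<open>r\<close> has been attained equally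
  often before; from there on one sequence attains \<open>r\<close> again and the other one does not.
\<close>
lemma decseq_eq_if_level_cards_eq:
  fixes s t :: "nat \<Rightarrow> real"
  assumes "decseq s" "decseq t" "\<And>j. 0 \<le> s j" "\<And>j. 0 \<le> t j"
    and fin: "\<And>r. r > 0 \<Longrightarrow> finite {j. s j = r}" "\<And>r. r > 0 \<Longrightarrow> finite {j. t j = r}"
    and card: "\<And>r. r > 0 \<Longrightarrow> card {j. s j = r} = card {j. t j = r}"
  shows "s = t"
proof
  fix k
  show "s k = t k"
  proof (induction k rule: less_induct)
    case (less k)
    have False if "decseq u" "\<And>j. 0 \<le> u j" "decseq v" "\<And>j. 0 \<le> v j" "\<And>j. j < k \<Longrightarrow> u j = v j" "v k < u k"
      "\<And>r. r > 0 \<Longrightarrow> finite {j. u j = r}"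
      "\<And>r. r > 0 \<Longrightarrow> card {j. u j = r} = card {j. v j = r}" for u v :: "nat \<Rightarrow> real"
    proof -
      have "0 < u k" using that(4)[of k] that(6) by linarith
      have "{j. v j = u k} \<subseteq> {j. j < k \<and> u j = u k}"
      proof clarify
        fix j assume "v j = u k"
        then have "\<not> k \<le> j" using decseqD[OF \<open>decseq v\<close>, of k j] that(6) by auto
        then show "j < k \<and> u j = u k" using that(5)[of j] \<open>v j = u k\<close> by simp
      qed
      also have "\<dots> \<subset> {j. u j = u k}" by auto
      finally have "card {j. v j = u k} < card {j. u j = u k}"
        using that(7)[OF \<open>0 < u k\<close>] by (intro psubset_card_mono)
      then show False using that(8)[OF \<open>0 < u k\<close>] by simp
    qed
    from this[of s t] this[of t s] assms less show ?case
      by (metis linorder_cases)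
  qed
qed

text \<open>
  The operator is its own absolute value, and \<open>s\<close> is the only decreasing enumeration of its positive
  eigenvalues with the prescribed multiplicities.
\<close>
lemma singular_value_diagonal:
  assumes e: "orthonormal_seq e" and s: "decseq s" "\<And>n. 0 < s n" "s \<longlonglongrightarrow> 0"
  shows "singular_value k (diagonal_op e s) = s k"
proof -
  have bound: "s \<in> l_inf"
    using convergent_imp_bounded[OF s(3)] by (simp add: l_inf_def)
  have fin: "finite {j. s j = r}" if "r > 0" for r
  proof -
    have "eventually (\<lambda>j. s j < r) sequentially" using s(3) that by (rule order_tendstoD)
    then obtain N where N: "\<And>j. j \<ge> N \<Longrightarrow> s j < r" unfolding eventually_sequentially by blast
    have "j < N" if "s j = r" for j using N[of j] that by (cases "j < N") auto
    then have "{j. s j = r} \<subseteq> {..<N}" by auto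
    then show ?thesis by (rule finite_subset) simp
  qed
  have dim: "complex_vector.dim (eigenspace (diagonal_op e s) (complex_of_real r)) = card {j. s j = r}"
    if "r > 0" for r
    by (rule dim_eigenspace_diagonal[OF e bound]) (use that fin in auto)
  have "(THE t :: nat \<Rightarrow> real. decseq t \<and> (\<forall>j. 0 \<le> t j) \<and> (\<forall>r>0. finite {j. t j = r} \<and>
      card {j. t j = r} = complex_vector.dim (eigenspace (abs_op (diagonal_op e s)) (complex_of_real r)))) = s"
    unfolding abs_op_diagonal[OF e bound s(2)]
  proof (rule the_equality)
    show "decseq s \<and> (\<forall>j. 0 \<le> s j) \<and> (\<forall>r>0. finite {j. s j = r} \<and>
        card {j. s j = r} = complex_vector.dim (eigenspace (diagonal_op e s) (complex_of_real r)))"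
      using s fin dim by (simp add: less_imp_le)
  next
    fix t :: "nat \<Rightarrow> real" assume "decseq t \<and> (\<forall>j. 0 \<le> t j) \<and> (\<forall>r>0. finite {j. t j = r} \<and>
        card {j. t j = r} = complex_vector.dim (eigenspace (diagonal_op e s) (complex_of_real r)))"
    then show "t = s"
      using s fin dim by (intro decseq_eq_if_level_cards_eq) (auto simp: less_imp_le)
  qed
  then show ?thesis by (simp add: singular_value_def)
qed

lemma compact_finite_rank_coefficients:
  "\<exists>K. compact K \<and> (\<forall>c. (\<forall>n<N. cmod (c n) \<le> D) \<longrightarrow> (\<Sum>n<N. c n *\<^sub>C e n) \<in> K)"
  for e :: "nat \<Rightarrow> 'a::complex_hilbert"
proof (induction N)
  case 0
  show ?case by (intro exI[of _ "{0}"]) auto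
next
  case (Suc N)
  then obtain K where K: "compact K" "\<And>c. (\<forall>n<N. cmod (c n) \<le> D) \<Longrightarrow> (\<Sum>n<N. c n *\<^sub>C e n) \<in> K"
    by blast
  let ?L = "(\<lambda>c. c *\<^sub>C e N) ` cball 0 D"
  have "compact ?L"
    by (intro compact_continuous_image linear_continuous_on bounded_linear_scaleC_left) simp
  then have "compact {x + y |x y. x \<in> K \<and> y \<in> ?L}" using K(1) by (intro compact_sums)
  moreover have "(\<Sum>n<Suc N. c n *\<^sub>C e n) \<in> {x + y |x y. x \<in> K \<and> y \<in> ?L}"
    if c: "\<forall>n<Suc N. cmod (c n) \<le> D" for c
  proof -
    have "(\<Sum>n<N. c n *\<^sub>C e n) \<in> K" using c by (intro K(2)) auto
    moreover have "c N *\<^sub>C e N \<in> ?L" using c by auto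
    ultimately show ?thesis by auto
  qed
  ultimately show ?case by blast
qed

text \<open>
  The first \<open>N\<close> coordinates of the image of the unit ball range over a compact set, and the rest has norm
  at most \<open>sup {\<bar>d n\<bar> | n \<ge> N}\<close>; so the image is totally bounded.
\<close>
lemma compact_op_diagonal:
  assumes e: "orthonormal_seq e" and d: "d \<longlonglongrightarrow> 0"
  shows "compact_op (diagonal_op e d)"
proof -
  have bounded: "d \<in> l_inf"
    using convergent_imp_bounded[OF d] by (simp add: l_inf_def)
  then obtain D where D: "\<And>n. \<bar>d n\<bar> \<le> D" by (rule l_infE) blast
  have "compact (closure (diagonal_op e d ` cball 0 1))"
    unfolding compact_eq_totally_bounded
  proof (intro conjI allI impI)
    show "complete (closure (diagonal_op e d ` cball 0 1))" by (simp add: complete_eq_closed)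
  next
    fix \<epsilon> :: real assume "\<epsilon> > 0"
    then obtain N where N: "\<And>n. n \<ge> N \<Longrightarrow> \<bar>d n\<bar> \<le> \<epsilon> / 4"
      using LIMSEQ_D[OF d, of "\<epsilon> / 4"] by (force intro: less_imp_le)
    obtain K where K: "compact K" "\<And>c. (\<forall>n<N. cmod (c n) \<le> D) \<Longrightarrow> (\<Sum>n<N. c n *\<^sub>C e n) \<in> K"
      using compact_finite_rank_coefficients[of N D e] by blast
    then obtain F where F: "finite F" "K \<subseteq> (\<Union>x\<in>F. ball x (\<epsilon> / 4))"
      using \<open>\<epsilon> > 0\<close> unfolding compact_eq_totally_bounded by (meson divide_pos_pos zero_less_numeral)
    have "diagonal_op e d ` cball 0 1 \<subseteq> (\<Union>x\<in>F. cball x (\<epsilon> / 2))"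
    proof (rule image_subsetI)
      fix x :: 'a assume "x \<in> cball 0 1"
      then have x: "norm x \<le> 1" by simp
      let ?c = "\<lambda>n. complex_of_real (d n) * cinner x (e n)"
      let ?tail = "\<lambda>n. if n < N then 0 else d n"
      have "cmod (cinner x (e n)) \<le> 1" for n
      proof -
        have "(norm (e n))\<^sup>2 = 1"
          using e cinner_self[of "e n"] by (simp add: orthonormal_seq_def flip: of_real_power)
        then have "norm (e n) = 1" using norm_ge_zero[of "e n"] by (auto simp: power2_eq_1_iff)
        then show ?thesis using norm_cinner_le[of x "e n"] x by simp
      qed
      then have "cmod (?c n) \<le> D" for n
        using D[of n] mult_mono[of "\<bar>d n\<bar>" D "cmod (cinner x (e n))" 1] by (simp add: norm_mult)
      then have "(\<Sum>n<N. ?c n *\<^sub>C e n) \<in> K" by (intro K(2)) simp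
      then obtain z where z: "z \<in> F" "dist z (\<Sum>n<N. ?c n *\<^sub>C e n) < \<epsilon> / 4" using F(2) by auto
      have "(\<lambda>n. ?c n *\<^sub>C e n - (if n \<in> {..<N} then ?c n *\<^sub>C e n else 0)) sums
          (diagonal_op e d x - (\<Sum>n<N. ?c n *\<^sub>C e n))"
        unfolding diagonal_op_def
        by (intro sums_diff summable_sums summable_diagonal[OF e bounded] sums_If_finite_set) simp
      moreover have "(\<lambda>n. ?c n *\<^sub>C e n - (if n \<in> {..<N} then ?c n *\<^sub>C e n else 0))
          = (\<lambda>n. (complex_of_real (?tail n) * cinner x (e n)) *\<^sub>C e n)"
        by auto
      ultimately have "diagonal_op e d x - (\<Sum>n<N. ?c n *\<^sub>C e n) = diagonal_op e ?tail x"
        unfolding diagonal_op_def by (metis (no_types, lifting) sums_unique)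
      also have "norm \<dots> \<le> \<epsilon> / 4 * norm x"
        by (rule norm_diagonal_op_le[OF e]) (use N \<open>\<epsilon> > 0\<close> in auto)
      also have "\<dots> \<le> \<epsilon> / 4 * 1" using x \<open>\<epsilon> > 0\<close> by (intro mult_left_mono) auto
      finally have "dist (diagonal_op e d x) (\<Sum>n<N. ?c n *\<^sub>C e n) \<le> \<epsilon> / 4" by (simp add: dist_norm)
      with z(2) have "dist z (diagonal_op e d x) \<le> \<epsilon> / 2"
        using dist_triangle2[of z "diagonal_op e d x" "\<Sum>n<N. ?c n *\<^sub>C e n"] by simp
      with z(1) show "diagonal_op e d x \<in> (\<Union>x\<in>F. cball x (\<epsilon> / 2))" by auto
    qed
    then have "closure (diagonal_op e d ` cball 0 1) \<subseteq> (\<Union>x\<in>F. cball x (\<epsilon> / 2))"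
      by (rule closure_minimal) (use F(1) in \<open>intro closed_UN; simp\<close>)
    also have "\<dots> \<subseteq> (\<Union>x\<in>F. ball x \<epsilon>)" using \<open>\<epsilon> > 0\<close> by (intro UN_mono) auto
    finally show "\<exists>k. finite k \<and> closure (diagonal_op e d ` cball 0 1) \<subseteq> (\<Union>x\<in>k. ball x \<epsilon>)"
      using F(1) by blast
  qed
  then show ?thesis using bounded_op_diagonal[OF e bounded] by (simp add: compact_op_def)
qed

section \<open>Comparison of the two suprema\<close>

text \<open>
  The last complete gap before \<open>t\<close> stretches from \<open>2 ^ (2 * 4 ^ i)\<close> to \<open>2 ^ (3 * 4 ^ i)\<close>, and \<open>t\<close> is less than
  \<open>2 ^ (12 * 4 ^ i)\<close>; on the logarithmic scale this is a proportion of at least \<open>(3 - 2) / 12\<close>.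
  Such a gap exists because the first one ends at \<open>8\<close>.
\<close>
lemma log_cesaro_gaps_ge:
  fixes x :: "nat \<Rightarrow> real"
  defines "x \<equiv> indicator lacunary_gaps"
  assumes t: "8 \<le> t"
  shows "1 / 12 \<le> log_cesaro (step_embedding x) t"
proof -
  let ?f = "step_embedding x"
  have f01: "0 \<le> ?f s \<and> ?f s \<le> 1" if "0 < s" for s
    using step_embedding_in_range[OF that, of x] by (metis indicator_pos_le indicator_le_1 x_def)
  define i where "i = (LEAST i. t < 2 ^ (3 * 4 ^ Suc i))"
  have "\<exists>i. t < 2 ^ (3 * 4 ^ Suc i)"
  proof -
    obtain n where "t < 2 ^ n" using real_arch_pow[of 2 t] by auto
    also have "(2::real) ^ n \<le> 2 ^ (3 * 4 ^ Suc n)"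
    proof (rule power_increasing)
      have "n < 4 ^ n" by (rule power_gt_expt) simp
      then show "n \<le> 3 * 4 ^ Suc n" by simp
    qed simp
    finally show ?thesis by blast
  qed
  then have upper: "t < 2 ^ (3 * 4 ^ Suc i)" unfolding i_def by (rule LeastI_ex)
  have lower: "2 ^ (3 * 4 ^ i) \<le> t"
  proof (cases i)
    case (Suc j)
    then have "j < (LEAST i. t < 2 ^ (3 * 4 ^ Suc i))" by (simp add: i_def)
    from not_less_Least[OF this] show ?thesis by (simp add: Suc)
  qed (use t in simp)
  define p :: real where "p = 2 ^ (2 * 4 ^ i)"
  define q :: real where "q = 2 ^ (3 * 4 ^ i)"
  have p: "1 \<le> p" and "p \<le> q" and "q \<le> t"
    using lower by (auto simp: p_def q_def intro!: power_increasing)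
  have one: "?f s = 1" if s: "p < s" "s < q" for s
  proof -
    define n where "n = nat (\<lceil>s\<rceil> - 1)"
    have n: "real n < s" "s \<le> real n + 1" using s p unfolding n_def by linarith+
    have "real (2 ^ (2 * 4 ^ i)) < real (Suc n)"
      using s(1) n(2) unfolding p_def of_nat_power of_nat_numeral of_nat_Suc by linarith
    moreover have "real n < real (2 ^ (3 * 4 ^ i))"
      using s(2) n(1) unfolding q_def of_nat_power of_nat_numeral by linarith
    ultimately have "n \<in> lacunary_gaps"
      unfolding of_nat_less_iff lacunary_gaps_def less_Suc_eq_le by blast
    then show ?thesis using step_embedding_eq[OF n, of x] by (simp add: x_def)
  qed
  have "1 * (ln q - ln p) \<le> log_integral ?f p q"
    unfolding log_integral_def
    by (rule LBINT_between_logs(2)[where u = 1]) (use p \<open>p \<le> q\<close> one in auto)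
  also have "log_integral ?f p q \<le> log_integral ?f 1 p + log_integral ?f p q + log_integral ?f q t"
    using log_integral_bounds(1)[OF borel_measurable_step_embedding f01, of 1 p]
      log_integral_bounds(1)[OF borel_measurable_step_embedding f01, of q t] p \<open>p \<le> q\<close> \<open>q \<le> t\<close>
    by simp
  also have "\<dots> = log_integral ?f 1 t"
    using log_integral_sum[OF borel_measurable_step_embedding f01, of 1 p q]
      log_integral_sum[OF borel_measurable_step_embedding f01, of 1 q t] p \<open>p \<le> q\<close> \<open>q \<le> t\<close>
    by simp
  finally have int: "4 ^ i * ln 2 \<le> log_integral ?f 1 t"
    by (simp add: p_def q_def ln_realpow mult.commute)
  have "ln t \<le> ln (2 ^ (3 * 4 ^ Suc i))" using upper t by (subst ln_le_cancel_iff) auto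
  also have "\<dots> = 12 * (4 ^ i * ln 2)" by (simp add: ln_realpow)
  finally have "ln t \<le> 12 * log_integral ?f 1 t" using int by linarith
  moreover have "0 < ln t" using t by simp
  ultimately show ?thesis by (simp add: log_cesaro_eq field_simps)
qed

text \<open>
  Up to a null sequence, \<open>lacunary_mean\<close> is at most \<open>\<kappa> - \<kappa> / 2 * x\<close> with \<open>x\<close> the indicator of the gaps,
  and the limit of \<open>x\<close> is at least \<open>1 / 12\<close>.
\<close>
lemma connes_dixmier_limit_lacunary_mean_le:
  assumes \<omega>: "gen_limit_seq \<omega>" and \<gamma>: "gen_limit_fun \<gamma>"
    and eq: "\<omega> = \<gamma> \<circ> log_cesaro \<circ> step_embedding"
  shows "\<omega> lacunary_mean \<le> 4 / (3 * ln 2) - 1 / (18 * ln 2)"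
proof -
  define \<kappa> :: real where "\<kappa> = 4 / (3 * ln 2)"
  define x :: "nat \<Rightarrow> real" where "x = indicator lacunary_gaps"
  define z where "z n = 10 / ln (2 + real n)" for n
  have x: "x \<in> l_inf" by (rule l_infI[of _ 1]) (simp add: x_def indicator_def)
  have "z \<longlonglongrightarrow> 0" unfolding z_def by real_asymp
  then have z: "z \<in> l_inf" using convergent_imp_bounded by (simp add: l_inf_def)
  have const: "(\<lambda>_. \<kappa>) \<in> l_inf" by (rule l_infI[of _ "\<bar>\<kappa>\<bar>"]) simp
  note closed = l_inf_scale[OF x, of "- (\<kappa> / 2)"] l_inf_add[OF const l_inf_scale[OF x, of "- (\<kappa> / 2)"]]
  have f01: "0 \<le> step_embedding x s \<and> step_embedding x s \<le> 1" if "0 < s" for s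
    using step_embedding_in_range[OF that, of x] by (metis indicator_pos_le indicator_le_1 x_def)
  have "1 / 12 \<le> \<gamma> (log_cesaro (step_embedding x))"
  proof (rule gen_limit_fun_ge[OF \<gamma> log_cesaro_in_L_inf[OF borel_measurable_step_embedding f01]])
    show "eventually (\<lambda>t. 1 / 12 \<le> log_cesaro (step_embedding x) t) at_top"
      unfolding x_def by (rule eventually_mono[OF eventually_ge_at_top log_cesaro_gaps_ge])
  qed
  then have gaps: "1 / 12 \<le> \<omega> x" by (simp add: eq)
  have "\<omega> lacunary_mean \<le> \<omega> (\<lambda>n. \<kappa> + - (\<kappa> / 2) * x n + z n)"
  proof (rule gen_limit_seq_mono[OF \<omega> lacunary_mean_bounded l_inf_add[OF closed(2) z]])
    fix n
    have ln: "9 / ln (2 + real n) \<le> z n" unfolding z_def by (intro divide_right_mono) auto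
    show "lacunary_mean n \<le> \<kappa> + - (\<kappa> / 2) * x n + z n"
    proof (cases "n \<in> lacunary_gaps")
      case True
      then show ?thesis using lacunary_mean_le_on_gaps[OF True] by (simp add: x_def \<kappa>_def z_def field_simps)
    next
      case False
      then show ?thesis using lacunary_mean_le[of n] ln by (simp add: x_def \<kappa>_def)
    qed
  qed
  also have "\<dots> = \<omega> (\<lambda>_. \<kappa>) + \<omega> (\<lambda>n. - (\<kappa> / 2) * x n) + \<omega> z"
    by (simp only: gen_limit_seq_add[OF \<omega> closed(2) z] gen_limit_seq_add[OF \<omega> const closed(1)])
  also have "\<dots> = \<kappa> - \<kappa> / 2 * \<omega> x"
    using gen_limit_seq_tendsto[OF \<omega> \<open>z \<longlonglongrightarrow> 0\<close>] gen_limit_seq_tendsto[OF \<omega> tendsto_const, of \<kappa>]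
    by (simp add: gen_limit_seq_scale[OF \<omega> x, of "- (\<kappa> / 2)", simplified])
  also have "\<dots> \<le> \<kappa> - \<kappa> / 2 * (1 / 12)"
    using gaps by (intro diff_left_mono mult_left_mono) (simp_all add: \<kappa>_def)
  finally show ?thesis by (simp add: \<kappa>_def field_simps)
qed

theorem theorem2p2:
  assumes separable: "separable_space (euclidean :: 'h::complex_hilbert topology)"
    and infinite_dimensional: "\<And>B :: 'h set. finite B \<Longrightarrow> complex_vector.span B \<noteq> UNIV"
  shows "\<exists>T\<^sub>0 :: 'h \<Rightarrow> 'h. T\<^sub>0 \<in> dixmier_ideal \<and> positive_op T\<^sub>0 \<and>
    (SUP \<tau>\<in>dixmier_traces. ereal (Re (\<tau> T\<^sub>0))) >
    (SUP \<tau>\<in>connes_dixmier_traces. ereal (Re (\<tau> T\<^sub>0)))"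
proof -
  obtain e :: "nat \<Rightarrow> 'h" where e: "orthonormal_seq e"
    using exists_orthonormal_seq[OF infinite_dimensional] by blast
  define T where "T = diagonal_op e lacunary_seq"
  have "log_mean T = lacunary_mean"
    unfolding log_mean_def lacunary_mean_def T_def sum_lacunary_seq[symmetric]
      singular_value_diagonal[OF e decseq_lacunary_seq lacunary_seq_pos lacunary_seq_tendsto_0] ..
  have "positive_op T"
    unfolding T_def
  proof (rule positive_op_diagonal[OF e _ less_imp_le[OF lacunary_seq_pos]])
    show "lacunary_seq \<in> l_inf"
      using convergent_imp_bounded[OF lacunary_seq_tendsto_0] by (simp add: l_inf_def)
  qed
  have "T \<in> dixmier_ideal"
    using compact_op_diagonal[OF e lacunary_seq_tendsto_0] lacunary_mean_bounded
    by (simp add: dixmier_ideal_def T_def[symmetric] \<open>log_mean T = _\<close> l_inf_def bounded_imp_bdd_above)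
  have trace: "Re (dixmier_trace \<omega> T) = \<omega> lacunary_mean" for \<omega>
    using \<open>T \<in> dixmier_ideal\<close> \<open>positive_op T\<close>
    by (simp add: dixmier_trace_def dixmier_weight_def \<open>log_mean T = _\<close>)
  have "(SUP \<tau>\<in>connes_dixmier_traces. ereal (Re (\<tau> T))) \<le> ereal (4 / (3 * ln 2) - 1 / (18 * ln 2))"
  proof (rule SUP_least)
    fix \<tau> :: "('h \<Rightarrow> 'h) \<Rightarrow> complex" assume "\<tau> \<in> connes_dixmier_traces"
    then obtain \<omega> \<gamma> where "\<tau> = dixmier_trace \<omega>" "gen_limit_seq \<omega>" "gen_limit_fun \<gamma>"
      "\<omega> = \<gamma> \<circ> log_cesaro \<circ> step_embedding"
      unfolding connes_dixmier_traces_def by blast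
    then show "ereal (Re (\<tau> T)) \<le> ereal (4 / (3 * ln 2) - 1 / (18 * ln 2))"
      using connes_dixmier_limit_lacunary_mean_le by (simp add: trace)
  qed
  also have "\<dots> < ereal (4 / (3 * ln 2))"
  proof -
    have "0 < 1 / (18 * ln (2::real))" by simp
    then show ?thesis unfolding less_ereal.simps(1) by linarith
  qed
  also have "\<dots> \<le> (SUP \<tau>\<in>dixmier_traces. ereal (Re (\<tau> T)))"
  proof -
    obtain \<omega> where \<omega>: "gen_limit_seq \<omega>" "dilation_invariant \<omega>" "4 / (3 * ln 2) \<le> \<omega> lacunary_mean"
      using exists_dilation_invariant_limit_ge[OF lacunary_mean_bounded lacunary_mean_large_after_jump]
      by blast
    then have "(dixmier_trace \<omega> :: ('h \<Rightarrow> 'h) \<Rightarrow> complex) \<in> dixmier_traces"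
      unfolding dixmier_traces_def by blast
    then show ?thesis by (rule SUP_upper2) (use \<omega>(3) in \<open>simp add: trace\<close>)
  qed
  finally show ?thesis using \<open>T \<in> dixmier_ideal\<close> \<open>positive_op T\<close> by blast
qed

end
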